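(* Let $\theta_\ast=(\theta_{\ast,1},\dots,\theta_{\ast,m})\in\mathbb R^m$, $m\ge2$, be a parameter of the distribution of i.i.d. random variables $X_1,\dots,X_N$ with values in a measurable space, randomly partitioned into disjoint groups $G_1,\dots,G_k$ of cardinality $n=\lfloor N/k\rfloor$ each, and let $\bar\theta_j=\bar\theta_j(G_j)=(\bar\theta_{j,1},\dots,\bar\theta_{j,m})\in\mathbb R^m$, $1\le j\le k$, be the i.i.d. estimators of $\theta_\ast$ obtained from the groups. Let $\rho_1,\dots,\rho_m:\mathbb R\to\mathbb R$ be convex, even functions such that $\rho_i(z)\to\infty$ as $|z|\to\infty$ and $\|\rho_i'\|_\infty<\infty$, where $\rho_i'(x)$ is the average of the right and left derivatives of $\rho_i$ at $x$, and let $$\widehat\theta^{(k)}:=\operatorname*{argmin}_{z\in\mathbb R^m}\sum_{j=1}^k\sum_{i=1}^m\rho_i(z_i-\bar\theta_{j,i}).$$ Let $C_{\rho_i}>0$ be such that $|\rho_{+,i}'(x)|\ge\frac{\|\rho_{+,i}'\|_\infty}{2}$ and $|\rho_{-,i}'(x)|\ge\frac{\|\rho_{-,i}'\|_\infty}{2}$ for $|x|>C_{\rho_i}$, $i=1,\dots,m$, where $\rho_{+,i}'$ and $\rho_{-,i}'$ are the right and left derivatives of $\rho_i$. Assume that there are sequences $\{\sigma_{n,i}\}_{n\in\mathbb N}$ of positive numbers, $i=1,\dots,m$, such that $$g_m(n):=\max_{i=1,\dots,m}\sup_{t\in\mathbb R}\Big|\mathbb P\Big(\frac{\bar\theta_{1,i}-\theta_{\ast,i}}{\sigma_{n,i}}\le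 t\Big)-\Phi(t)\Big|\to0\quad\text{as } n\to\infty,$$ and suppose that $s>0$ and $n=\lfloor N/k\rfloor$ are such that $$\max_{i=1,\dots,m}e^{(C_{\rho_i}/\sigma_{n,i})^2}\Big(\sqrt{\tfrac sk}+2g_m(n)\Big)\le0.33 .$$ Then for all such $s$, with probability at least $1-4me^{-2s}$, for all $1\le i\le m$ simultaneously, $$\big|\widehat\theta^{(k)}_i-\theta_{\ast,i}\big|\le3e^{(C_{\rho_i}/\sigma_{n,i})^2}\cdot\sigma_{n,i}\Big(\sqrt{\tfrac sk}+2g_m(n)\Big).$$
   Context: $\Phi$ is the standard normal distribution function; $\|f\|_\infty$ is the essential supremum of $|f|$; $\widehat\theta^{(k)}_i$ is the $i$-th coordinate of $\widehat\theta^{(k)}$; the argmin denotes a minimizer. The partition into groups is independent of the data. *)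

theory Defs
  imports "HOL-Probability.Probability" "HOL-Probability.Essential_Supremum"
begin

definition right_deriv :: "(real \<Rightarrow> real) \<Rightarrow> real \<Rightarrow> real" where
  "right_deriv f x = (THE D. (f has_real_derivative D) (at_right x))"

definition left_deriv :: "(real \<Rightarrow> real) \<Rightarrow> real \<Rightarrow> real" where
  "left_deriv f x = (THE D. (f has_real_derivative D) (at_left x))"

definition avg_deriv :: "(real \<Rightarrow> real) \<Rightarrow> real \<Rightarrow> real" where
  "avg_deriv f x = (left_deriv f x + right_deriv f x) / 2"

definition Linf_norm :: "(real \<Rightarrow> real) \<Rightarrow> ereal" where
  "Linf_norm f = esssup lborel (\<lambda>x. ereal \<bar>f x\<bar>)"

text \<open>The observations of \<open>X\<close> with indices in the finite set \<open>A\<close>, arranged as a tuple of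
  length \<open>card A\<close> in increasing order of their indices.\<close>

definition group_sample :: "(nat \<Rightarrow> 'a \<Rightarrow> 'b) \<Rightarrow> nat set \<Rightarrow> 'a \<Rightarrow> nat \<Rightarrow> 'b" where
  "group_sample X A \<omega> = (\<lambda>l\<in>{..<card A}. X (sorted_list_of_set A ! l) \<omega>)"

text \<open>\<open>T n j\<close> is the estimator (a function of \<open>n\<close> observations) used in the \<open>j\<close>-th group when
  the groups have \<open>n\<close> elements.  The error of the normal approximation has to be defined for all
  group sizes \<open>n\<close>, so it is expressed with the law of \<open>T n 1\<close> under the \<open>n\<close>-fold product of the
  distribution \<open>P\<close> of a single observation.\<close>

definition normal_approx_error ::
  "'b measure \<Rightarrow> (nat \<Rightarrow> nat \<Rightarrow> (nat \<Rightarrow> 'b) \<Rightarrow> real ^ 'm) \<Rightarrow> real ^ 'm \<Rightarrow> (nat \<Rightarrow> 'm \<Rightarrow> real) \<Rightarrow> nat \<Rightarrow> real"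
  where
  "normal_approx_error P T \<theta> \<sigma> n =
    (MAX i. SUP t. \<bar>\<P>(x in (\<Pi>\<^sub>M l\<in>{..<n}. P). (T n 1 x $ i - \<theta> $ i) / \<sigma> n i \<le> t)
                    - cdf std_normal_distribution t\<bar>)"

end

theory Submission
  imports Defs
begin

text \<open>Fix a coordinate and normalize: let \<open>W\<close> be the standardized error of one estimator, \<open>\<psi>\<close> the
  rescaled right derivative of the loss, and \<open>a = sqrt (s / k)\<close>. By the subgradient inequality the
  minimizer exceeds the claimed bound \<open>e\<close> only if \<open>\<Sum>\<^sub>j \<psi> (e - W\<^sub>j) \<le> 0\<close>; the lower side follows by
  reflection because the loss is even. Hoeffding's inequality for variables in \<open>[-1, 1]\<close> does not give
  the constant 3, because \<open>\<psi>\<close> is only known to be at least \<open>1/2\<close> beyond \<open>c = C / \<sigma>\<close> and may be close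
  to 1 far out. Instead we bound the Laplace transform \<open>E exp (- l \<psi> (e - W))\<close> at \<open>l = 3 a\<close> by
  \<open>exp (- 2 a\<^sup>2)\<close>.

  Replacing \<open>W\<close> by a standard normal variable costs at most \<open>g (exp l - exp (- l))\<close>, since the integrand
  is monotone. In the Gaussian integral the points \<open>x\<close> and \<open>- x\<close> are paired. Writing
  \<open>\<psi> = (1 + \<eta>) / 2\<close> and using convexity of the exponential, the contribution of \<open>\<eta>\<close> is bounded by
  the integral of \<open>\<eta> D\<close>, where \<open>D\<close> changes sign once, from plus to minus, and has nonpositive
  integral. As \<open>\<eta>\<close> is nondecreasing, this contribution is nonpositive, so the case \<open>\<psi> = 1/2\<close> beyond
  \<open>c\<close> is extremal. What remains is an explicit inequality between hyperbolic functions.\<close>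

section \<open>Elementary inequalities\<close>

lemma cosh_sinh_Maclaurin:
  fixes x :: real
  assumes "0 < x"
  shows "\<exists>t. 0 < t \<and> t \<le> x \<and> cosh x = 1 + x ^ 2 / 2 + cosh t * x ^ 4 / 24"
    and "\<exists>t. 0 < t \<and> t \<le> x \<and> sinh x = x + x ^ 3 / 6 + cosh t * x ^ 5 / 120"
proof -
  have D: "((if even m then cosh else sinh) has_real_derivative
      (if even (Suc m) then cosh else sinh) t) (at t)"
    "((if even m then sinh else cosh) has_real_derivative
      (if even (Suc m) then sinh else cosh) t) (at t)" for m and t :: real
    by (auto intro!: derivative_eq_intros)
  show "\<exists>t. 0 < t \<and> t \<le> x \<and> cosh x = 1 + x ^ 2 / 2 + cosh t * x ^ 4 / 24"
    using Maclaurin2[of x "\<lambda>m. if even m then cosh else sinh" cosh 4] assms D(1)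
    by (simp add: lessThan_nat_numeral lessThan_Suc fact_numeral) (auto simp: algebra_simps)
  show "\<exists>t. 0 < t \<and> t \<le> x \<and> sinh x = x + x ^ 3 / 6 + cosh t * x ^ 5 / 120"
    using Maclaurin2[of x "\<lambda>m. if even m then sinh else cosh" sinh 5] assms D(2)
    by (simp add: lessThan_nat_numeral lessThan_Suc fact_numeral) (auto simp: algebra_simps)
qed

lemma cosh_le_numeral:
  fixes x :: real
  shows "\<lbrakk>0 \<le> x; x \<le> 1/2\<rbrakk> \<Longrightarrow> cosh x \<le> 6/5" and "\<lbrakk>0 \<le> x; x \<le> 1\<rbrakk> \<Longrightarrow> cosh x \<le> 17/10"
proof -
  have mono: "cosh x \<le> cosh y" if "0 \<le> x" "x \<le> y" for x y :: real
    using cosh_real_nonneg_le_iff that by force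
  have "exp (1/2) \<le> (7/4 :: real)"
    using exp_bound[of "1/2"] by (simp add: power2_eq_square)
  moreover have "13/8 \<le> exp (1/2 :: real)"
    using exp_lower_Taylor_quadratic[of "1/2"] by (simp add: power2_eq_square)
  then have "exp (- (1/2)) \<le> (8/13 :: real)"
    by (simp add: exp_minus field_simps)
  ultimately have half: "cosh (1/2) \<le> (6/5 :: real)"
    by (simp add: cosh_def)
  have "exp 1 \<le> (3 :: real)" by (rule exp_le)
  moreover have "5/2 \<le> exp (1 :: real)"
    using exp_lower_Taylor_quadratic[of 1] by simp
  then have "exp (- 1) \<le> (2/5 :: real)"
    by (simp add: exp_minus field_simps)
  ultimately have one: "cosh 1 \<le> (17/10 :: real)"
    by (simp add: cosh_def)
  show "cosh x \<le> 6/5" if "0 \<le> x" "x \<le> 1/2"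
    using mono[OF that] half by linarith
  show "cosh x \<le> 17/10" if "0 \<le> x" "x \<le> 1"
    using mono[OF that] one by linarith
qed

text \<open>The Lagrange remainders are nonnegative, hence the lower bounds. For the upper bounds,
  the remainder coefficients 1/24 and 1/120 are multiplied by 6/5 and 17/10, the bounds of cosh on
  the respective ranges, which gives 1/20 and 17/1200.\<close>

lemma cosh_sinh_bounds:
  fixes x :: real
  assumes "0 \<le> x"
  shows "1 + x ^ 2 / 2 \<le> cosh x" and "x + x ^ 3 / 6 \<le> sinh x"
    and "x \<le> 1/2 \<Longrightarrow> cosh x \<le> 1 + x ^ 2 / 2 + x ^ 4 / 20"
    and "x \<le> 1 \<Longrightarrow> sinh x \<le> x + x ^ 3 / 6 + 17 * x ^ 5 / 1200"
proof -
  have "(1 + x ^ 2 / 2 \<le> cosh x) \<and> (x + x ^ 3 / 6 \<le> sinh x) \<and>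
    (x \<le> 1/2 \<longrightarrow> cosh x \<le> 1 + x ^ 2 / 2 + x ^ 4 / 20) \<and>
    (x \<le> 1 \<longrightarrow> sinh x \<le> x + x ^ 3 / 6 + 17 * x ^ 5 / 1200)"
  proof (cases "x = 0")
    case False
    then have "0 < x" using assms by simp
    obtain t where t: "0 < t" "t \<le> x" "cosh x = 1 + x ^ 2 / 2 + cosh t * x ^ 4 / 24"
      using cosh_sinh_Maclaurin(1)[OF \<open>0 < x\<close>] by blast
    obtain r where r: "0 < r" "r \<le> x" "sinh x = x + x ^ 3 / 6 + cosh r * x ^ 5 / 120"
      using cosh_sinh_Maclaurin(2)[OF \<open>0 < x\<close>] by blast
    have pos: "0 \<le> cosh t * x ^ 4" "0 \<le> cosh r * x ^ 5"
      using assms by simp_all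
    moreover have "cosh t * x ^ 4 \<le> 6/5 * x ^ 4" if "x \<le> 1/2"
      by (rule mult_right_mono) (use cosh_le_numeral(1)[of t] t that in auto)
    moreover have "cosh r * x ^ 5 \<le> 17/10 * x ^ 5" if "x \<le> 1"
      by (rule mult_right_mono) (use cosh_le_numeral(2)[of r] r that assms in auto)
    ultimately show ?thesis
      using t(3) r(3) by auto
  qed simp
  then show "1 + x ^ 2 / 2 \<le> cosh x" "x + x ^ 3 / 6 \<le> sinh x"
    "x \<le> 1/2 \<Longrightarrow> cosh x \<le> 1 + x ^ 2 / 2 + x ^ 4 / 20"
    "x \<le> 1 \<Longrightarrow> sinh x \<le> x + x ^ 3 / 6 + 17 * x ^ 5 / 1200"
    by auto
qed

text \<open>Stopping after the cubic term leaves a Lagrange remainder with the even power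
  \<open>y ^ 4\<close>, which is nonnegative for either sign of \<open>y\<close>.\<close>

lemma exp_minus_ge_cubic:
  fixes y :: real
  shows "1 - y + y ^ 2 / 2 - y ^ 3 / 6 \<le> exp (- y)"
  using Maclaurin_exp_le[of "- y" 4]
  by (auto simp: lessThan_nat_numeral lessThan_Suc fact_numeral)

text \<open>The Taylor coefficient of order three is -1/3. Replacing it by -1/4 leaves a surplus
  \<open>t ^ 3 / 12\<close> that absorbs the terms of order five up to t = 3/4. This covers the
  later argument \<open>9/4 * a\<close> with a at most 33/100.\<close>

lemma tanh_le_cubic:
  fixes t :: real
  assumes "0 \<le> t" "t \<le> 3/4"
  shows "tanh t \<le> t - t ^ 3 / 4"
proof -
  have t2: "t ^ 2 \<le> (3/4) ^ 2" using assms by (rule power_mono[rotated])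
  then have t24: "t ^ 2 \<le> 9/16" by (simp add: power2_eq_square)
  have "0 \<le> t * (4 - t ^ 2)" using assms t24 by (intro mult_nonneg_nonneg) auto
  then have nonneg: "0 \<le> t - t ^ 3 / 4" by (simp add: algebra_simps power2_eq_square power3_eq_cube)
  have "sinh t \<le> t + t ^ 3 / 6 + 17 * t ^ 5 / 1200"
    using cosh_sinh_bounds(4)[of t] assms by simp
  also have "\<dots> \<le> (t - t ^ 3 / 4) * (1 + t ^ 2 / 2)"
  proof -
    have "0 \<le> t ^ 3 * (1/12 - (1/8 + 17/1200) * t ^ 2)"
      using assms t24 by (intro mult_nonneg_nonneg) auto
    then show ?thesis by (simp add: field_simps power_numeral_reduce)
  qed
  also have "\<dots> \<le> (t - t ^ 3 / 4) * cosh t"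
    using nonneg cosh_sinh_bounds(1)[of t] assms by (intro mult_left_mono) auto
  finally show ?thesis
    by (simp add: tanh_def field_simps cosh_real_pos)
qed

text \<open>The integral over \<open>{0..u}\<close> of a Taylor polynomial below \<open>exp (- v\<^sup>2 / 2)\<close>.\<close>

definition gauss_poly :: "real \<Rightarrow> real" where
  "gauss_poly u = u - u ^ 3 / 6 + u ^ 5 / 40 - u ^ 7 / 336"

lemma gauss_poly_ge_cubic:
  assumes "0 \<le> u" "u \<le> 1"
  shows "u - u ^ 3 / 6 \<le> gauss_poly u"
proof -
  have "u ^ 2 \<le> 1" using assms by (simp add: power_le_one)
  then have "0 \<le> u ^ 5 * (1/40 - u ^ 2 / 336)"
    using assms by (intro mult_nonneg_nonneg) auto
  then show ?thesis
    by (simp add: gauss_poly_def algebra_simps power_numeral_reduce)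
qed

lemma gauss_poly_nonneg: "\<lbrakk>0 \<le> u; u \<le> 1\<rbrakk> \<Longrightarrow> 0 \<le> gauss_poly u"
proof -
  assume u: "0 \<le> u" "u \<le> 1"
  then have "u ^ 2 \<le> 1" by (simp add: power_le_one)
  then have "0 \<le> u * (1 - u ^ 2 / 6)" using u by (intro mult_nonneg_nonneg) auto
  then show ?thesis
    using gauss_poly_ge_cubic[OF u] by (simp add: algebra_simps power_numeral_reduce)
qed

text \<open>Centering a Gaussian window at c instead of 0 costs a factor
  \<open>exp (- c\<^sup>2 / 2)\<close>. With \<open>y = exp (c\<^sup>2 / 2)\<close> this shows that
  widening the window by \<open>y ^ 2\<close> makes up for that loss, which is the origin of the
  factor \<open>exp (c\<^sup>2)\<close> in the final bound.\<close>

lemma gauss_poly_scale: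
  assumes "0 \<le> u" "1 \<le> y" "y ^ 2 * u \<le> 1"
  shows "y * gauss_poly u \<le> gauss_poly (y ^ 2 * u)"
proof -
  \<comment> \<open>For r > 0 this is \<open>gauss_poly (r ^ 2 * u) / r\<close>, so the claim
    reduces to monotonicity of \<open>F\<close> between 1 and y.\<close>
  define F where "F r = r * u - r ^ 5 * u ^ 3 / 6 + r ^ 9 * u ^ 5 / 40 - r ^ 13 * u ^ 7 / 336" for r
  define F' where "F' r = u - 5 * r ^ 4 * u ^ 3 / 6 + 9 * r ^ 8 * u ^ 5 / 40 - 13 * r ^ 12 * u ^ 7 / 336" for r
  have F: "gauss_poly (r ^ 2 * u) = r * F r" for r
    by (simp add: gauss_poly_def F_def power_mult_distrib algebra_simps power_numeral_reduce)
  have "F 1 \<le> F y"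
  proof (rule DERIV_nonneg_imp_nondecreasing[OF assms(2)])
    fix r assume r: "1 \<le> r" "r \<le> y"
    define w where "w = r ^ 2 * u"
    have w: "0 \<le> w" "w \<le> 1"
      using r assms mult_right_mono[OF power_mono[of r y 2] assms(1)] by (auto simp: w_def)
    have "F' r = u * (1 - 5/6 * w ^ 2 + w ^ 4 * (9/40 - 13/336 * w ^ 2))"
      by (simp add: F'_def w_def power_mult_distrib algebra_simps power_numeral_reduce)
    also have "\<dots> \<ge> 0"
    proof -
      have "w ^ 2 \<le> 1" using w by (simp add: power_le_one)
      then show ?thesis using assms(1) by (intro mult_nonneg_nonneg add_nonneg_nonneg) auto
    qed
    finally have "0 \<le> F' r" .
    moreover have "(F has_real_derivative F' r) (at r)"
      unfolding F_def F'_def by (auto intro!: derivative_eq_intros simp: field_simps)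
    ultimately show "\<exists>D. (F has_real_derivative D) (at r) \<and> D \<ge> 0" by blast
  qed
  moreover have "F 1 = gauss_poly u" by (simp add: F_def gauss_poly_def)
  ultimately show ?thesis
    using assms(2) F[of y] by (auto intro: mult_left_mono)
qed

lemma concave_gauss_poly: "concave_on {0..1} gauss_poly"
proof (rule f''_le0_imp_concave)
  fix x :: real assume x: "x \<in> {0..1}"
  show "(gauss_poly has_real_derivative 1 - x ^ 2 / 2 + x ^ 4 / 8 - x ^ 6 / 48) (at x)"
    unfolding gauss_poly_def by (auto intro!: derivative_eq_intros simp: field_simps)
  show "((\<lambda>x. 1 - x ^ 2 / 2 + x ^ 4 / 8 - x ^ 6 / 48) has_real_derivative - x + x ^ 3 / 2 - x ^ 5 / 8) (at x)"
    by (auto intro!: derivative_eq_intros simp: field_simps)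
  have "x ^ 2 \<le> 1" using x by (simp add: power_le_one)
  then have "0 \<le> x * (1 - x ^ 2 / 2)" using x by (intro mult_nonneg_nonneg) auto
  moreover have "0 \<le> x ^ 5" using x by simp
  ultimately show "- x + x ^ 3 / 2 - x ^ 5 / 8 \<le> 0"
    by (simp add: algebra_simps power_numeral_reduce)
qed simp

text \<open>The following expression in \<open>\<delta> = a + 2 g\<close> bounds the Laplace transform at \<open>3 a\<close>. It is convex in
  \<open>\<delta>\<close>, so only \<open>\<delta> = a\<close> and \<open>\<delta> = 33/100\<close> have to be checked. The constant \<open>7978/10000\<close> is a
  lower bound of \<open>2 / sqrt (2 * pi)\<close>.\<close>

lemma chernoff_endpoint_small:
  fixes a :: real
  assumes "0 \<le> a" "a \<le> 33/100"
  shows "cosh (3/2 * a) - sinh (3/2 * a) * (7978/10000 * gauss_poly (3 * a)) \<le> exp (- 2 * a ^ 2)"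
proof -
  define x where "x = 3/2 * a"
  have x: "0 \<le> x" "x \<le> 495/1000" and a: "3 * a = 2 * x" "- 2 * a ^ 2 = - (8/9 * x ^ 2)"
    using assms by (auto simp: x_def power2_eq_square)
  have x2: "x ^ 2 \<le> 1/4" using power_mono[of x "1/2" 2] x by (simp add: power2_eq_square)
  have nn: "0 \<le> 2 * x - (2 * x) ^ 3 / 6"
  proof -
    have "0 \<le> x * (2 - 4/3 * x ^ 2)" using x x2 by (intro mult_nonneg_nonneg) auto
    then show ?thesis by (simp add: algebra_simps power_numeral_reduce)
  qed
  have "(x + x ^ 3 / 6) * (7978/10000 * (2 * x - (2 * x) ^ 3 / 6)) \<le> sinh x * (7978/10000 * gauss_poly (2 * x))"
    using x nn cosh_sinh_bounds(2)[of x] gauss_poly_ge_cubic[of "2 * x"] by (intro mult_mono) auto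
  moreover have "cosh x \<le> 1 + x ^ 2 / 2 + x ^ 4 / 20"
    using cosh_sinh_bounds(3)[of x] x by simp
  moreover have "1 - 8/9 * x ^ 2 + (8/9 * x ^ 2) ^ 2 / 2 - (8/9 * x ^ 2) ^ 3 / 6 \<le> exp (- (8/9 * x ^ 2))"
    by (rule exp_minus_ge_cubic)
  moreover have "1 + x ^ 2 / 2 + x ^ 4 / 20 - (x + x ^ 3 / 6) * (7978/10000 * (2 * x - (2 * x) ^ 3 / 6))
      \<le> 1 - 8/9 * x ^ 2 + (8/9 * x ^ 2) ^ 2 / 2 - (8/9 * x ^ 2) ^ 3 / 6"
  proof -
    \<comment> \<open>In the difference of the right and left sides the coefficient of
      \<open>x ^ 2\<close> is about 0.207. The quartic and sextic terms are negative and are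
      absorbed because \<open>x ^ 2\<close> is at most 1/4.\<close>
    have "0 \<le> x ^ 2 * (1/4 - x ^ 2) * x ^ 2" "0 \<le> x ^ 2 * (1/4 - x ^ 2)" "0 \<le> x ^ 6"
      using x x2 by (auto intro!: mult_nonneg_nonneg)
    then show ?thesis by (simp add: field_simps power_numeral_reduce)
  qed
  ultimately have "cosh x - sinh x * (7978/10000 * gauss_poly (2 * x)) \<le> exp (- (8/9 * x ^ 2))"
    by linarith
  then show ?thesis by (simp only: x_def[symmetric] a)
qed

lemma chernoff_endpoint_large:
  fixes a :: real
  assumes "0 \<le> a" "a \<le> 33/100"
  shows "cosh (3/2 * a) - sinh (3/2 * a) * (7978/10000 * gauss_poly (99/100)
           - 2 * (33/100 - a) * cosh (3/2 * a)) \<le> exp (- 2 * a ^ 2)"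
proof -
  define x where "x = 3/2 * a"
  have x: "0 \<le> x" "x \<le> 495/1000" and a: "2 * (33/100 - a) = 66/100 - 4/3 * x" "- 2 * a ^ 2 = - (8/9 * x ^ 2)"
    using assms by (auto simp: x_def power2_eq_square)
  have p: "6775/10000 \<le> 7978/10000 * gauss_poly (99/100)"
    by (simp add: gauss_poly_def power_numeral_reduce)
  have "(x + x ^ 3 / 6) * (6775/10000) \<le> sinh x * (7978/10000 * gauss_poly (99/100))"
    using x p cosh_sinh_bounds(2)[of x] by (intro mult_mono) auto
  moreover have "sinh x * ((66/100 - 4/3 * x) * cosh x) \<le> (66/100 - 4/3 * x) * (x + 2/3 * x ^ 3 + 17/75 * x ^ 5)"
  proof -
    have "2 * (sinh x * cosh x) = sinh (2 * x)" by (simp add: sinh_double)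
    also have "\<dots> \<le> 2 * x + (2 * x) ^ 3 / 6 + 17 * (2 * x) ^ 5 / 1200"
      using cosh_sinh_bounds(4)[of "2 * x"] x by simp
    finally have "sinh x * cosh x \<le> x + 2/3 * x ^ 3 + 17/75 * x ^ 5"
      by (simp add: power_mult_distrib)
    then have "(66/100 - 4/3 * x) * (sinh x * cosh x) \<le> (66/100 - 4/3 * x) * (x + 2/3 * x ^ 3 + 17/75 * x ^ 5)"
      using x by (intro mult_left_mono) auto
    then show ?thesis by (simp add: algebra_simps)
  qed
  moreover have "cosh x \<le> 1 + x ^ 2 / 2 + x ^ 4 / 20"
    using cosh_sinh_bounds(3)[of x] x by simp
  moreover have "1 - 8/9 * x ^ 2 + (8/9 * x ^ 2) ^ 2 / 2 - (8/9 * x ^ 2) ^ 3 / 6 \<le> exp (- (8/9 * x ^ 2))"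
    by (rule exp_minus_ge_cubic)
  moreover have "1 + x ^ 2 / 2 + x ^ 4 / 20 - (x + x ^ 3 / 6) * (6775/10000)
        + (66/100 - 4/3 * x) * (x + 2/3 * x ^ 3 + 17/75 * x ^ 5)
      \<le> 1 - 8/9 * x ^ 2 + (8/9 * x ^ 2) ^ 2 / 2 - (8/9 * x ^ 2) ^ 3 / 6" (is "?l \<le> ?r")
  proof -
    \<comment> \<open>The left side minus the right side is at most \<open>x * E\<close>: the term
      of order five has been merged into the quartic one by means of x <= 495/1000.\<close>
    define E where "E = - 175/10000 + 5/90 * x + 32709/100000 * x ^ 2 - 1159/1000 * x ^ 3"
    \<comment> \<open>For x >= 0 the cubic \<open>E\<close> has its maximum close to 1/4, where it
      is only slightly negative. A multiple of this cubic with a double root at 1/4 therefore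
      certifies the sign.\<close>
    have "0 \<le> (x - 1/4) ^ 2 * (x + 2178/10000)" using x by simp
    moreover have "x * x \<le> 1/2 * (1/2)" using x by (intro mult_mono) auto
    ultimately have "E \<le> 0"
      using x by (simp add: E_def field_simps power_numeral_reduce)
    then have "0 \<le> x * (- E)" using x by (intro mult_nonneg_nonneg) auto
    moreover have "0 \<le> x ^ 4 * (495/1000 - x)" "0 \<le> x ^ 2" "0 \<le> x ^ 4" "0 \<le> x ^ 3" "0 \<le> x ^ 6"
      using x by auto
    ultimately show ?thesis
      by (simp add: E_def field_simps power_numeral_reduce)
  qed
  ultimately have "cosh x - (sinh x * (7978/10000 * gauss_poly (99/100))
           - sinh x * ((66/100 - 4/3 * x) * cosh x)) \<le> exp (- (8/9 * x ^ 2))"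
    by linarith
  then have "cosh x - sinh x * (7978/10000 * gauss_poly (99/100)
           - (66/100 - 4/3 * x) * cosh x) \<le> exp (- (8/9 * x ^ 2))"
    by (simp only: right_diff_distrib)
  then show ?thesis by (simp only: x_def[symmetric] a)
qed

lemma chernoff_numeric:
  fixes a \<delta> :: real
  assumes "0 \<le> a" "a \<le> \<delta>" "\<delta> \<le> 33/100"
  shows "cosh (3/2 * a) - sinh (3/2 * a) * (7978/10000 * gauss_poly (3 * \<delta>)
           - 2 * (\<delta> - a) * cosh (3/2 * a)) \<le> exp (- 2 * a ^ 2)"
\<comment> \<open>If a = 33/100, the interval from a to 33/100 is a single point. Otherwise
  \<open>t\<close> is the relative position of \<delta> in it. Besides the concave
  \<open>gauss_poly\<close>, the bound depends on \<delta> only through an affine term.\<close>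
proof (cases "a = 33/100")
  case True
  then have "\<delta> = 33/100" "3 * (33/100) = (99/100 :: real)" using assms by simp_all
  then show ?thesis using assms chernoff_endpoint_large[of a] by metis
next
  case False
  then have a: "a < 33/100" using assms by simp
  define t where "t = (\<delta> - a) / (33/100 - a)"
  have t: "0 \<le> t" "t \<le> 1" "t * (33/100 - a) = \<delta> - a"
    using a assms by (auto simp: t_def)
  then have \<delta>: "\<delta> = (1 - t) * a + t * (33/100)"
    by (simp add: algebra_simps)
  let ?C = "cosh (3/2 * a)" and ?S = "sinh (3/2 * a)" and ?s = "7978/10000 :: real"
  have S: "0 \<le> ?S" using assms by simp
  have "(1 - t) * gauss_poly (3 * a) + t * gauss_poly (99/100)
      \<le> gauss_poly ((1 - t) * (3 * a) + t * (99/100))"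
    using concave_onD[OF concave_gauss_poly t(1,2), of "3 * a" "99/100"] a assms by simp
  also have "(1 - t) * (3 * a) + t * (99/100) = 3 * \<delta>"
    by (simp add: \<delta> algebra_simps)
  finally have "?S * (?s * ((1 - t) * gauss_poly (3 * a) + t * gauss_poly (99/100))) \<le> ?S * (?s * gauss_poly (3 * \<delta>))"
    using S by (intro mult_left_mono) auto
  then have "?C - ?S * (?s * gauss_poly (3 * \<delta>) - 2 * (\<delta> - a) * ?C)
      \<le> ?C - ?S * (?s * ((1 - t) * gauss_poly (3 * a) + t * gauss_poly (99/100)) - 2 * (\<delta> - a) * ?C)"
    by (simp add: algebra_simps)
  also have "\<dots> = (1 - t) * (?C - ?S * (?s * gauss_poly (3 * a)))
      + t * (?C - ?S * (?s * gauss_poly (99/100) - 2 * (33/100 - a) * ?C))"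
    by (simp add: \<delta> field_simps)
  also have "\<dots> \<le> (1 - t) * exp (- 2 * a ^ 2) + t * exp (- 2 * a ^ 2)"
    using t a assms chernoff_endpoint_small[of a] chernoff_endpoint_large[of a]
    by (intro add_mono mult_left_mono) auto
  finally show ?thesis by (simp add: algebra_simps)
qed

text \<open>For \<open>l = 3 * a\<close> the left side is \<open>tanh (3/4 * l)\<close>. Together
  with \<open>central_mass_ge\<close> at c = 0 and with e >= 3 a, this supplies the condition that
  makes the integral of D in the extremal argument nonpositive.\<close>

lemma tanh_le_gauss_poly:
  fixes a :: real
  assumes "0 \<le> a" "a \<le> 33/100"
  shows "tanh (9/4 * a) \<le> 7978/10000 * gauss_poly (3 * a)"
proof -
  have a2: "a ^ 2 \<le> 1089/10000" using power_mono[of a "33/100" 2] assms by (simp add: power2_eq_square)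
  have "tanh (9/4 * a) \<le> 9/4 * a - (9/4 * a) ^ 3 / 4"
    using assms by (intro tanh_le_cubic) auto
  also have "\<dots> \<le> 7978/10000 * (3 * a - (3 * a) ^ 3 / 6)"
  proof -
    have "0 \<le> a * (1089/10000 - a ^ 2)" using assms a2 by (intro mult_nonneg_nonneg) auto
    then show ?thesis using assms by (simp add: algebra_simps power_numeral_reduce)
  qed
  also have "\<dots> \<le> 7978/10000 * gauss_poly (3 * a)"
    using gauss_poly_ge_cubic[of "3 * a"] assms by simp
  finally show ?thesis .
qed

section \<open>Gaussian integrals\<close>

text \<open>Reflection preserves Lebesgue measure, so the integral of f is half that of the folded
  function \<open>f x + f (- x)\<close>. Comparisons may thus fail pointwise as long as they hold
  for each pair.\<close>

lemma integral_nonneg_of_pairs: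
  fixes f :: "real \<Rightarrow> real"
  assumes f: "integrable lborel f" and pair: "\<And>x. 0 < x \<Longrightarrow> 0 \<le> f x + f (- x)"
  shows "0 \<le> (\<integral>x. f x \<partial>lborel)"
proof -
  have refl: "(\<integral>x. f x \<partial>lborel) = (\<integral>x. f (- x) \<partial>lborel)"
    using lborel_integral_real_affine[of "-1" f 0] by simp
  have f': "integrable lborel (\<lambda>x. f (- x))"
    using lborel_integrable_real_affine[OF f, of "-1" 0] by simp
  have "0 \<le> f x + f (- x)" if "x \<noteq> 0" for x
    using pair[of x] pair[of "- x"] that by (cases "0 < x") auto
  then have "0 \<le> (\<integral>x. f x + f (- x) \<partial>lborel)"
    by (intro integral_nonneg_AE) (use AE_lborel_singleton[of 0] in auto)
  also have "\<dots> = 2 * (\<integral>x. f x \<partial>lborel)"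
    using f f' refl by simp
  finally show ?thesis by simp
qed

section \<open>Integrals against the normal density and the mass of intervals\<close>

lemma measure_std_normal:
  assumes [measurable]: "A \<in> sets borel"
  shows "measure std_normal_distribution A = (\<integral>x. indicator A x * std_normal_density x \<partial>lborel)"
proof -
  interpret N: prob_space std_normal_distribution
    using prob_space_normal_density[of 1 0] by simp
  have "measure std_normal_distribution A = (\<integral>x. indicator A x \<partial>std_normal_distribution)"
    by simp
  also have "\<dots> = (\<integral>x. std_normal_density x *\<^sub>R indicator A x \<partial>lborel)"
    by (rule integral_density) auto
  finally show ?thesis by (simp add: mult.commute)
qed

lemma integrable_bounded_mult_normal:
  fixes b :: "real \<Rightarrow> real"
  assumes [measurable]: "b \<in> borel_measurable borel" and "\<And>x. \<bar>b x\<bar> \<le> B"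
  shows "integrable lborel (\<lambda>x. b x * std_normal_density (x - m))"
proof (rule Bochner_Integration.integrable_bound)
  have "integrable lborel (\<lambda>x. std_normal_density (- m + 1 * x))"
    by (intro lborel_integrable_real_affine) auto
  then show "integrable lborel (\<lambda>x. B * std_normal_density (x - m))"
    by (simp add: algebra_simps)
  show "AE x in lborel. norm (b x * std_normal_density (x - m)) \<le> norm (B * std_normal_density (x - m))"
    using assms(2) by (intro AE_I2) (auto simp: abs_mult intro!: mult_right_mono order_trans[OF _ abs_ge_self])
qed simp

lemma std_normal_density_minus: "std_normal_density (- x) = std_normal_density x"
  by (simp add: std_normal_density_def)

lemma integral_normal_shift:
  fixes b :: "real \<Rightarrow> real"
  shows "(\<integral>x. b x * std_normal_density (x - m) \<partial>lborel) = (\<integral>z. b (m - z) * std_normal_density z \<partial>lborel)"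
  using lborel_integral_real_affine[of "-1" "\<lambda>x. b x * std_normal_density (x - m)" m]
  by (simp add: std_normal_density_minus)

text \<open>For nonnegative c and e and a standard normal Z this is P(e - Z > c) - P(e - Z < - c),
  the bias towards the positive side that a shift by e produces; see
  \<open>integral_sign_normal\<close>.\<close>

definition central_mass :: "real \<Rightarrow> real \<Rightarrow> real" where
  "central_mass c e = measure std_normal_distribution {c - e<..c + e}"

lemma sqrt_two_pi_bound: "7978/10000 \<le> 2 / sqrt (2 * pi)"
proof -
  have "(7978/20000 :: real)\<^sup>2 * (2 * pi) \<le> 1"
    using pi_approx(2) by (simp add: power2_eq_square)
  then have "sqrt ((7978/20000)\<^sup>2 * (2 * pi)) \<le> 1" by simp
  then have "7978/20000 * sqrt (2 * pi) \<le> 1" by (simp add: real_sqrt_mult)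
  then show ?thesis by (simp add: field_simps)
qed

text \<open>The densities at c + v and c - v add up to twice the density at c times
  \<open>exp (- (v\<^sup>2 / 2)) * cosh (c * v)\<close>. Since cosh is at least 1, the dependence on
  c reduces to the factor \<open>exp (- c\<^sup>2 / 2)\<close>. The rest is bounded below by its
  Taylor polynomial, whose integral over \<open>{- e..e}\<close> is \<open>2 * gauss_poly e\<close>
  because \<open>gauss_poly\<close> is odd.\<close>

lemma central_mass_ge:
  assumes "0 \<le> e" "e \<le> 1"
  shows "7978/10000 * exp (- c\<^sup>2 / 2) * gauss_poly e \<le> central_mass c e"
proof -
  define q where "q v = 1 - v ^ 2 / 2 + v ^ 4 / 8 - v ^ 6 / 48" for v :: real
  define s where "s = exp (- c\<^sup>2 / 2) / sqrt (2 * pi)"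
  have s: "0 \<le> s" by (simp add: s_def)
  define f where "f v = indicator {- e..e} v * std_normal_density (v - (- c)) - s * (q v * indicator {- e..e} v)" for v
  have q: "has_bochner_integral lborel (\<lambda>v. q v * indicator {- e..e} v) (gauss_poly e - gauss_poly (- e))"
  proof (rule has_bochner_integral_FTC_Icc_real)
    show "- e \<le> e" using assms by simp
    fix v show "DERIV gauss_poly v :> q v"
      unfolding gauss_poly_def q_def by (auto intro!: derivative_eq_intros simp: field_simps)
    show "isCont q v" unfolding q_def by (intro continuous_intros) auto
  qed
  have i1: "integrable lborel (\<lambda>v. indicator {- e..e} v * std_normal_density (v - (- c)))"
    by (rule integrable_bounded_mult_normal[where B = 1]) (auto simp: indicator_def)
  have i2: "integrable lborel (\<lambda>v. q v * indicator {- e..e} v)"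
    using q by (simp add: has_bochner_integral_iff)
  have "0 \<le> (\<integral>v. f v \<partial>lborel)"
  proof (rule integral_nonneg_of_pairs)
    show "integrable lborel f" unfolding f_def using i1 i2 by auto
    fix v :: real assume "0 < v"
    show "0 \<le> f v + f (- v)"
    proof (cases "v \<le> e")
      case True
      have "q v = 1 - v\<^sup>2 / 2 + (v\<^sup>2 / 2) ^ 2 / 2 - (v\<^sup>2 / 2) ^ 3 / 6"
        by (simp add: q_def power_divide flip: power_mult)
      then have q_le: "q v \<le> exp (- (v\<^sup>2 / 2))"
        using exp_minus_ge_cubic[of "v\<^sup>2 / 2"] by simp
      have "std_normal_density (v + c) + std_normal_density (- v + c) = s * (2 * (exp (- (v\<^sup>2 / 2)) * cosh (c * v)))"
      proof -
        have "std_normal_density (v + c) = s * (exp (- (v\<^sup>2 / 2)) * exp (- (c * v)))"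
          "std_normal_density (- v + c) = s * (exp (- (v\<^sup>2 / 2)) * exp (c * v))"
          by (simp_all add: std_normal_density_def s_def power2_sum power2_diff field_simps flip: exp_add)
        then show ?thesis by (simp add: cosh_def algebra_simps)
      qed
      also have "\<dots> \<ge> s * (2 * q v)"
      proof -
        have "exp (- (v\<^sup>2 / 2)) * 1 \<le> exp (- (v\<^sup>2 / 2)) * cosh (c * v)"
          by (intro mult_left_mono cosh_real_ge_1) auto
        then have "2 * q v \<le> 2 * (exp (- (v\<^sup>2 / 2)) * cosh (c * v))" using q_le by linarith
        then show ?thesis using s by (rule mult_left_mono)
      qed
      finally have "s * (2 * q v) \<le> std_normal_density (v + c) + std_normal_density (- v + c)" .
      moreover have "q (- v) = q v" by (simp add: q_def)
      ultimately show ?thesis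
        using True \<open>0 < v\<close> by (simp add: f_def)
    qed (use \<open>0 < v\<close> in \<open>simp add: f_def\<close>)
  qed
  also have "(\<integral>v. f v \<partial>lborel) = (\<integral>v. indicator {- e..e} v * std_normal_density (v - (- c)) \<partial>lborel)
      - s * (gauss_poly e - gauss_poly (- e))"
    unfolding f_def using i1 i2 q by (simp add: has_bochner_integral_integral_eq)
  also have "(\<integral>v. indicator {- e..e} v * std_normal_density (v - (- c)) \<partial>lborel)
      = (\<integral>z. indicator {- e..e} (- c - z) * std_normal_density z \<partial>lborel)"
    by (rule integral_normal_shift)
  also have "\<dots> = (\<integral>z. indicator {- e..e} (- c - (- z)) * std_normal_density z \<partial>lborel)"
    using lborel_integral_real_affine[of "-1" "\<lambda>z. indicator {- e..e} (- c - z) * std_normal_density z" 0]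
    by (simp add: std_normal_density_minus)
  also have "\<dots> = (\<integral>z. indicator {c - e<..c + e} z * std_normal_density z \<partial>lborel)"
  \<comment> \<open>The closed and the half-open interval differ only in the null set consisting of
    c - e.\<close>
  proof (rule integral_cong_AE)
    show "AE z in lborel. indicator {- e..e} (- c - (- z)) * std_normal_density z
        = indicator {c - e<..c + e} z * std_normal_density z"
      using AE_lborel_singleton[of "c - e"] by eventually_elim (auto simp: indicator_def)
  qed auto
  also have "\<dots> = central_mass c e"
    unfolding central_mass_def by (rule measure_std_normal[symmetric]) auto
  finally have "s * (gauss_poly e - gauss_poly (- e)) \<le> central_mass c e" by simp
  moreover have "s * (gauss_poly e - gauss_poly (- e)) = 2 / sqrt (2 * pi) * (exp (- c\<^sup>2 / 2) * gauss_poly e)"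
    by (simp add: gauss_poly_def s_def field_simps)
  moreover have "7978/10000 * (exp (- c\<^sup>2 / 2) * gauss_poly e) \<le> 2 / sqrt (2 * pi) * (exp (- c\<^sup>2 / 2) * gauss_poly e)"
    using sqrt_two_pi_bound gauss_poly_nonneg[OF assms] by (intro mult_right_mono) auto
  ultimately show ?thesis by (simp add: mult.assoc)
qed

text \<open>A translation turns the first indicator, and a translation with reflection the second,
  into upper rays starting at c - e and c + e. These rays are nested, and their difference is the
  central interval.\<close>

lemma integral_sign_normal:
  assumes "0 \<le> c" "0 \<le> e"
  shows "(\<integral>x. (indicator {c<..} x - indicator {..< - c} x) * std_normal_density (x - e) \<partial>lborel)
    = central_mass c e"
proof -
  have i: "integrable lborel (\<lambda>x. indicator A x * std_normal_density (x - m))"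
    if [measurable]: "A \<in> sets borel" for A :: "real set" and m
    by (rule integrable_bounded_mult_normal[where B = 1]) (auto simp: indicator_def)
  have i0: "integrable lborel (\<lambda>x. indicator A x * std_normal_density x)"
    if "A \<in> sets borel" for A :: "real set"
    using i[OF that, of 0] by simp
  have "(\<integral>x. (indicator {c<..} x - indicator {..< - c} x) * std_normal_density (x - e) \<partial>lborel)
      = (\<integral>x. indicator {c<..} x * std_normal_density (x - e) \<partial>lborel)
        - (\<integral>x. indicator {..< - c} x * std_normal_density (x - e) \<partial>lborel)"
    by (subst Bochner_Integration.integral_diff[symmetric]) (auto intro!: i simp: left_diff_distrib)
  also have "(\<integral>x. indicator {c<..} x * std_normal_density (x - e) \<partial>lborel)
      = (\<integral>z. indicator {c<..} (e - (- z)) * std_normal_density z \<partial>lborel)"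
    unfolding integral_normal_shift
    using lborel_integral_real_affine[of "-1" "\<lambda>z. indicator {c<..} (e - z) * std_normal_density z" 0]
    by (simp add: std_normal_density_minus)
  also have "\<dots> = (\<integral>z. indicator {c - e<..} z * std_normal_density z \<partial>lborel)"
    by (intro Bochner_Integration.integral_cong) (auto simp: indicator_def)
  also have "(\<integral>x. indicator {..< - c} x * std_normal_density (x - e) \<partial>lborel)
      = (\<integral>z. indicator {c + e<..} z * std_normal_density z \<partial>lborel)"
    unfolding integral_normal_shift
    by (intro Bochner_Integration.integral_cong) (auto simp: indicator_def)
  also have "(\<integral>z. indicator {c - e<..} z * std_normal_density z \<partial>lborel)
      - (\<integral>z. indicator {c + e<..} z * std_normal_density z \<partial>lborel)
      = (\<integral>z. indicator {c - e<..c + e} z * std_normal_density z \<partial>lborel)"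
    unfolding Bochner_Integration.integral_diff[OF i0[of "{c - e<..}"] i0[of "{c + e<..}"], simplified, symmetric]
    using assms by (intro Bochner_Integration.integral_cong) (auto split: split_indicator)
  also have "\<dots> = central_mass c e"
    unfolding central_mass_def by (rule measure_std_normal[symmetric]) auto
  finally show ?thesis .
qed

text \<open>This is the chord of the exponential between l/2 and l, where \<open>2 * y - 1\<close>
  is the weight of l. It holds for either sign of l and makes the integrand affine in the excess
  \<eta>.\<close>

lemma exp_two_point_mix:
  fixes l y :: real
  assumes "1/2 \<le> y" "y \<le> 1"
  shows "exp (l * y) \<le> exp (l / 2) + (2 * y - 1) * (exp l - exp (l / 2))"
proof -
  have "convex_on UNIV (exp :: real \<Rightarrow> real)"
    by (rule f''_ge0_imp_convex[where f' = exp and f'' = exp]) (auto intro!: derivative_eq_intros)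
  from convex_onD[OF this, of "2 * y - 1" "l / 2" l] assms
  have "exp ((1 - (2 * y - 1)) * (l / 2) + (2 * y - 1) * l) \<le> (1 - (2 * y - 1)) * exp (l / 2) + (2 * y - 1) * exp l"
    by simp
  moreover have "(1 - (2 * y - 1)) * (l / 2) + (2 * y - 1) * l = l * y"
    by (simp add: field_simps)
  ultimately show ?thesis by (simp add: algebra_simps)
qed

lemma gaussian_laplace_bound:
  fixes \<psi> :: "real \<Rightarrow> real"
  assumes mono: "mono \<psi>" and bound: "\<And>x. \<bar>\<psi> x\<bar> \<le> 1" and odd: "\<And>x. 0 \<le> \<psi> x + \<psi> (- x)"
    and large: "\<And>x. c < x \<Longrightarrow> 1/2 \<le> \<psi> x"
    and c: "0 \<le> c" and e: "0 < e" and l: "0 < l" and tanh: "tanh (3/4 * l) \<le> central_mass 0 e"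
  shows "(\<integral>z. exp (- l * \<psi> (e - z)) * std_normal_density z \<partial>lborel)
    \<le> cosh (l / 2) - sinh (l / 2) * central_mass c e"
proof -
  \<comment> \<open>The excess of \<psi> over 1/2, rescaled to the unit interval. Truncation makes
    it vanish where \<psi> is below 1/2 and keeps it nondecreasing.\<close>
  define \<eta> where "\<eta> x = 2 * max (\<psi> x) (1/2) - 1" for x
  \<comment> \<open>The point at which \<open>exp (- l) * std_normal_density (x - e) + exp l * std_normal_density (x + e)\<close>
    stops exceeding the same expression with \<open>l / 2\<close> in place of \<open>l\<close>.\<close>
  define x0 where "x0 = 3/4 * l / e"
  define \<kappa> where "\<kappa> = cosh l - cosh (l / 2)"
  define \<kappa>' where "\<kappa>' = sinh l - sinh (l / 2)"
  define S where "S b x = (indicator {b<..} x - indicator {..< - b} x :: real)" for b x :: real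
  \<comment> \<open>After folding, \<open>u\<close> dominates the Laplace integrand. Its first two
    terms come from the extremal \<psi> with value 1/2 beyond c. The last term folds to D with the
    weight \<eta> frozen at \<open>x0\<close>.\<close>
  define u where "u x = cosh (l / 2) - sinh (l / 2) * S c x + \<eta> x0 * (\<kappa> - \<kappa>' * S 0 x)" for x
  have [measurable]: "\<psi> \<in> borel_measurable borel" by (rule borel_measurable_mono[OF mono])
  have [measurable]: "S b \<in> borel_measurable borel" for b unfolding S_def[abs_def] by simp
  have S_bound: "\<bar>S b x\<bar> \<le> 1" if "0 \<le> b" for b x using that by (auto simp: S_def indicator_def)
  have \<eta>: "0 \<le> \<eta> x" "\<eta> x \<le> 1" for x using bound[of x] by (auto simp: \<eta>_def)
  have \<eta>_mono: "\<eta> x \<le> \<eta> y" if "x \<le> y" for x y using monoD[OF mono that] by (auto simp: \<eta>_def)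
  have iS: "integrable lborel (\<lambda>x. S b x * std_normal_density (x - e))" if "0 \<le> b" for b
    by (rule integrable_bounded_mult_normal[where B = 1]) (use S_bound[OF that] in auto)
  have i1: "integrable lborel (\<lambda>x. std_normal_density (x - e))"
    using integrable_bounded_mult_normal[of "\<lambda>_. 1" 1 e] by simp
  have ih: "integrable lborel (\<lambda>x. exp (- l * \<psi> x) * std_normal_density (x - e))"
  proof (rule integrable_bounded_mult_normal[where B = "exp l"])
    show "\<bar>exp (- l * \<psi> x)\<bar> \<le> exp l" for x
      using mult_left_mono[of "- \<psi> x" 1 l] bound[of x] l by auto
  qed auto
  have int_u: "(\<lambda>x. u x * std_normal_density (x - e)) =
      (\<lambda>x. (cosh (l / 2) + \<eta> x0 * \<kappa>) * std_normal_density (x - e)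
        - sinh (l / 2) * (S c x * std_normal_density (x - e))
        - \<eta> x0 * \<kappa>' * (S 0 x * std_normal_density (x - e)))"
    by (simp add: u_def algebra_simps)
  have iu: "integrable lborel (\<lambda>x. u x * std_normal_density (x - e))"
    unfolding int_u using i1 iS[OF c] iS[of 0] by auto
  have one: "(\<integral>x. std_normal_density (x - e) \<partial>lborel) = 1"
    using integral_normal_shift[of "\<lambda>_. 1" e] by simp
  have "(\<integral>x. u x * std_normal_density (x - e) \<partial>lborel)
      = cosh (l / 2) + \<eta> x0 * \<kappa> - sinh (l / 2) * central_mass c e - \<eta> x0 * \<kappa>' * central_mass 0 e"
    unfolding int_u using i1 iS[OF c] iS[of 0] one e c
      integral_sign_normal[of c e] integral_sign_normal[of 0 e]
    by (simp add: S_def)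
  also have "\<dots> \<le> cosh (l / 2) - sinh (l / 2) * central_mass c e"
  proof -
    \<comment> \<open>The sum-to-product formulas give \<kappa> / \<kappa>' =
      \<open>tanh (3/4 * l)\<close>, so the hypothesis on tanh says that D has nonpositive
      integral.\<close>
    have k: "\<kappa>' = 2 * cosh (3/4 * l) * sinh (l / 4)" "\<kappa> = 2 * sinh (3/4 * l) * sinh (l / 4)"
      using cosh_add[of "3/4 * l" "l/4"] cosh_diff[of "3/4 * l" "l/4"]
        sinh_add[of "3/4 * l" "l/4"] sinh_diff[of "3/4 * l" "l/4"]
      by (simp_all add: \<kappa>_def \<kappa>'_def)
    have "\<kappa> = \<kappa>' * tanh (3/4 * l)"
      by (simp add: k tanh_def)
    also have "\<dots> \<le> \<kappa>' * central_mass 0 e"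
      using tanh l by (intro mult_left_mono) (auto simp: k)
    finally have "\<eta> x0 * \<kappa> \<le> \<eta> x0 * (\<kappa>' * central_mass 0 e)"
      using \<eta>(1) by (intro mult_left_mono) auto
    then show ?thesis by (simp add: algebra_simps)
  qed
  finally have main: "(\<integral>x. u x * std_normal_density (x - e) \<partial>lborel)
    \<le> cosh (l / 2) - sinh (l / 2) * central_mass c e" .
  have "0 \<le> (\<integral>x. u x * std_normal_density (x - e) - exp (- l * \<psi> x) * std_normal_density (x - e) \<partial>lborel)"
  proof (rule integral_nonneg_of_pairs)
    show "integrable lborel (\<lambda>x. u x * std_normal_density (x - e) - exp (- l * \<psi> x) * std_normal_density (x - e))"
      using iu ih by auto
    fix x :: real assume x: "0 < x"
    define A1 where "A1 = std_normal_density (x - e)"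
    define A2 where "A2 = std_normal_density (- x - e)"
    define D where "D = (exp (- l) - exp (- l / 2)) * A1 + (exp l - exp (l / 2)) * A2"
    have A: "0 \<le> A1" "0 \<le> A2" by (simp_all add: A1_def A2_def)
    \<comment> \<open>The likelihood ratio of x against - x increases with x; this is why D changes
      sign only once.\<close>
    have A12: "A1 = exp (2 * (e * x)) * A2"
      by (simp add: A1_def A2_def std_normal_density_def flip: exp_add)
         (simp add: field_simps power2_eq_square)
    have D: "D = (exp (- l / 2) - exp (- l)) * A2 * (exp (3/2 * l) - exp (2 * (e * x)))"
    proof -
      have "exp l - exp (l / 2) = (exp (- l / 2) - exp (- l)) * exp (3/2 * l)"
        by (simp add: left_diff_distrib flip: exp_add)
      then have "D = (exp (- l) - exp (- l / 2)) * (exp (2 * (e * x)) * A2)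
          + (exp (- l / 2) - exp (- l)) * exp (3/2 * l) * A2"
        by (simp only: D_def A12)
      then show ?thesis by (simp add: algebra_simps)
    qed
    have fac: "0 \<le> (exp (- l / 2) - exp (- l)) * A2" using l A by simp
    \<comment> \<open>D is nonnegative up to \<open>x0\<close> and nonpositive beyond, while \<eta>
      is nondecreasing. Freezing \<eta> at \<open>x0\<close> can therefore only increase the
      product.\<close>
    have cross: "\<eta> x * D \<le> \<eta> x0 * D"
    proof (cases "x \<le> x0")
      case True
      then have "2 * (e * x) \<le> 3/2 * l" using e by (simp add: x0_def field_simps)
      then have "0 \<le> D" unfolding D using fac by (intro mult_nonneg_nonneg[OF fac]) auto
      then show ?thesis using \<eta>_mono[OF True] by (rule mult_right_mono[rotated])
    next
      case False
      then have "3/2 * l \<le> 2 * (e * x)" using e by (simp add: x0_def field_simps)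
      then have "D \<le> 0" unfolding D using fac by (intro mult_nonneg_nonpos[OF fac]) auto
      then show ?thesis using \<eta>_mono[of x0 x] False by (intro mult_right_mono_neg) auto
    qed
    have y: "0 \<le> \<psi> x" "\<psi> x \<le> 1" "- \<psi> (- x) \<le> \<psi> x"
      using odd[of x] monoD[OF mono, of "- x" x] bound[of x] x by auto
    have "exp (- l * \<psi> x) * A1 + exp (- l * \<psi> (- x)) * A2 \<le> exp (- l * \<psi> x) * A1 + exp (l * \<psi> x) * A2"
      using mult_left_mono[OF y(3), of l] A l by (auto intro!: mult_right_mono)
    also have "\<dots> \<le> cosh (l / 2) * (A1 + A2) - sinh (l / 2) * S c x * (A1 - A2) + \<eta> x * D"
    \<comment> \<open>If \<psi> x is at least 1/2, the chord bound applies. Otherwise x <= c, so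
      \<open>S c x\<close> and \<open>\<eta> x\<close> vanish and the cosh part alone is
      enough.\<close>
    proof (cases "1/2 \<le> \<psi> x")
      case True
      then have \<eta>x: "\<eta> x = 2 * \<psi> x - 1" by (simp add: \<eta>_def)
      have "exp (- l * \<psi> x) * A1 + exp (l * \<psi> x) * A2
        \<le> (exp (- l / 2) + \<eta> x * (exp (- l) - exp (- l / 2))) * A1
          + (exp (l / 2) + \<eta> x * (exp l - exp (l / 2))) * A2"
        unfolding \<eta>x using exp_two_point_mix[of "\<psi> x" "- l"] exp_two_point_mix[of "\<psi> x" l] True y A
        by (intro add_mono mult_right_mono) auto
      also have "\<dots> = exp (- (l / 2)) * A1 + exp (l / 2) * A2 + \<eta> x * D"
        by (simp add: D_def algebra_simps)
      also have "exp (- (l / 2)) * A1 + exp (l / 2) * A2 = cosh (l / 2) * (A1 + A2) - sinh (l / 2) * 1 * (A1 - A2)"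
        by (simp add: cosh_def sinh_def field_simps)
      also have "\<dots> \<le> cosh (l / 2) * (A1 + A2) - sinh (l / 2) * S c x * (A1 - A2)"
      proof -
        have "0 \<le> A1 - A2"
          using A x e mult_right_mono[of 1 "exp (2 * (e * x))" A2] by (simp add: A12)
        moreover have "sinh (l / 2) * S c x \<le> sinh (l / 2) * 1"
          using S_bound[OF c, of x] l by (intro mult_left_mono) auto
        ultimately have "sinh (l / 2) * S c x * (A1 - A2) \<le> sinh (l / 2) * 1 * (A1 - A2)"
          by (intro mult_right_mono)
        then show ?thesis by simp
      qed
      finally show ?thesis by simp
    next
      case False
      then have "S c x = 0" "\<eta> x = 0"
        using large[of x] x c by (auto simp: S_def \<eta>_def indicator_def)
      have "exp (- l * \<psi> x) * A1 + exp (l * \<psi> x) * A2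
        = cosh (l * \<psi> x) * (A1 + A2) - sinh (l * \<psi> x) * (A1 - A2)"
        by (simp add: cosh_def sinh_def field_simps)
      also have "\<dots> \<le> cosh (l * \<psi> x) * (A1 + A2)"
        using A x e l y mult_right_mono[of 1 "exp (2 * (e * x))" A2] by (simp add: A12)
      also have "\<dots> \<le> cosh (l / 2) * (A1 + A2)"
      proof (rule mult_right_mono)
        have "l * \<psi> x \<le> l * (1/2)" using False l by (intro mult_left_mono) auto
        then show "cosh (l * \<psi> x) \<le> cosh (l / 2)"
          using l y cosh_real_nonneg_le_iff[of "l * \<psi> x" "l / 2"] by simp
      qed (use A in auto)
      finally show ?thesis using \<open>S c x = 0\<close> \<open>\<eta> x = 0\<close> by simp
    qed
    also have "\<dots> \<le> cosh (l / 2) * (A1 + A2) - sinh (l / 2) * S c x * (A1 - A2) + \<eta> x0 * D"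
      using cross by simp
    also have "\<dots> = u x * A1 + u (- x) * A2"
    proof -
      have "S b (- x) = - S b x" for b by (auto simp: S_def indicator_def)
      moreover have "S 0 x = 1" using x by (simp add: S_def)
      moreover have D': "D = \<kappa> * (A1 + A2) - \<kappa>' * (A1 - A2)"
        by (simp add: D_def \<kappa>_def \<kappa>'_def cosh_def sinh_def field_simps)
      ultimately show ?thesis unfolding D' by (simp add: u_def algebra_simps)
    qed
    finally show "0 \<le> u x * std_normal_density (x - e) - exp (- l * \<psi> x) * std_normal_density (x - e)
        + (u (- x) * std_normal_density (- x - e) - exp (- l * \<psi> (- x)) * std_normal_density (- x - e))"
      by (simp add: A1_def A2_def)
  qed
  then have "(\<integral>x. exp (- l * \<psi> x) * std_normal_density (x - e) \<partial>lborel) \<le> (\<integral>x. u x * std_normal_density (x - e) \<partial>lborel)"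
    using iu ih by simp
  with main integral_normal_shift[of "\<lambda>x. exp (- l * \<psi> x)" e] show ?thesis by linarith
qed

section \<open>Comparison with the normal distribution\<close>

text \<open>An upper set of reals is empty, the whole line, or an open or closed ray. The closed ray
  at the infimum covers U, and the endpoint it may add has no mass under \<nu>. Hence control of
  closed rays suffices even if \<mu> has atoms.\<close>

lemma upper_set_measure_le:
  fixes \<mu> \<nu> :: "real measure"
  assumes \<mu>: "prob_space \<mu>" "sets \<mu> = sets borel" and \<nu>: "prob_space \<nu>" "sets \<nu> = sets borel"
    and atomless: "\<And>t. measure \<nu> {t} = 0"
    and tail: "\<And>t. measure \<mu> {t..} \<le> measure \<nu> {t..} + g"
    and g: "0 \<le> g"
    and U: "U \<in> sets borel" "\<And>x y. x \<in> U \<Longrightarrow> x \<le> y \<Longrightarrow> y \<in> U"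
  shows "measure \<mu> U \<le> measure \<nu> U + g"
proof -
  interpret \<mu>: prob_space \<mu> by fact
  interpret \<nu>: prob_space \<nu> by fact
  have sp: "space \<nu> = UNIV" "space \<mu> = UNIV"
    using sets_eq_imp_space_eq[OF \<mu>(2)] sets_eq_imp_space_eq[OF \<nu>(2)] by (metis space_borel)+
  consider "U = {}" | "U \<noteq> {}" "\<not> bdd_below U" | "U \<noteq> {}" "bdd_below U" by fast
  then show ?thesis
  proof cases
    case 1
    then show ?thesis using g by simp
  next
    case 2
    have "x \<in> U" for x
    proof -
      obtain y where "y \<in> U" "\<not> x \<le> y" using 2 by (auto simp: bdd_below_def)
      then show ?thesis using U(2)[of y x] by simp
    qed
    then have "U = UNIV" by auto
    then have "measure \<nu> U = 1" using \<nu>.prob_space by (simp add: sp)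
    then show ?thesis using \<mu>.prob_le_1[of U] g by linarith
  next
    case 3
    let ?r = "Inf U"
    have "U \<subseteq> {?r..}" using 3 by (auto intro: cInf_lower)
    then have "measure \<mu> U \<le> measure \<mu> {?r..}"
      using \<mu>(2) by (intro \<mu>.finite_measure_mono) auto
    also have "\<dots> \<le> measure \<nu> {?r..} + g" by (rule tail)
    also have "{?r..} = {?r} \<union> {?r<..}" by auto
    also have "measure \<nu> ({?r} \<union> {?r<..}) \<le> measure \<nu> {?r} + measure \<nu> {?r<..}"
      using \<nu>(2) by (intro measure_Un_le) auto
    also have "measure \<nu> {?r<..} \<le> measure \<nu> U"
    proof (rule \<nu>.finite_measure_mono)
      show "{?r<..} \<subseteq> U"
      proof
        fix x assume "x \<in> {?r<..}"
        then obtain y where "y \<in> U" "y < x" using cInf_less_iff[OF 3, of x] by auto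
        then show "x \<in> U" using U(2)[of y x] by simp
      qed
    qed (use U(1) \<nu>(2) in auto)
    finally show ?thesis using atomless by simp
  qed
qed

text \<open>Tonelli for the region below the graph of q. Negative values contribute zero on both
  sides, because \<open>ennreal\<close> truncates them and t ranges over nonnegative levels.\<close>

lemma nn_integral_layer_cake:
  fixes q :: "'a \<Rightarrow> real"
  assumes "sigma_finite_measure \<mu>" and [measurable]: "q \<in> borel_measurable \<mu>"
  shows "(\<integral>\<^sup>+x. ennreal (q x) \<partial>\<mu>) = (\<integral>\<^sup>+t. indicator {0..} t * emeasure \<mu> {x \<in> space \<mu>. t < q x} \<partial>lborel)"
proof -
  interpret sigma_finite_measure \<mu> by fact
  interpret pair_sigma_finite lborel \<mu> ..
  have "(\<integral>\<^sup>+x. ennreal (q x) \<partial>\<mu>) = (\<integral>\<^sup>+x. (\<integral>\<^sup>+t. indicator {0..} t * indicator {(t, x). t < q x} (t, x) \<partial>lborel) \<partial>\<mu>)"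
  proof (rule nn_integral_cong)
    fix x
    have "(\<lambda>t. indicator {0..} t * indicator {(t, x). t < q x} (t, x) :: ennreal) = indicator {0..<q x}"
      by (auto simp: fun_eq_iff indicator_def)
    then show "ennreal (q x) = (\<integral>\<^sup>+t. indicator {0..} t * indicator {(t, x). t < q x} (t, x) \<partial>lborel)"
      by (cases "0 \<le> q x") (simp_all add: ennreal_neg)
  qed
  also have "\<dots> = (\<integral>\<^sup>+t. (\<integral>\<^sup>+x. indicator {0..} t * indicator {(t, x). t < q x} (t, x) \<partial>\<mu>) \<partial>lborel)"
    by (intro Fubini') measurable
  also have "\<dots> = (\<integral>\<^sup>+t. indicator {0..} t * emeasure \<mu> {x \<in> space \<mu>. t < q x} \<partial>lborel)"
  proof (rule nn_integral_cong)
    fix t :: real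
    have "(\<integral>\<^sup>+x. indicator {0..} t * indicator {(t, x). t < q x} (t, x) \<partial>\<mu>)
      = indicator {0..} t * (\<integral>\<^sup>+x. indicator {x \<in> space \<mu>. t < q x} x \<partial>\<mu>)"
      by (subst nn_integral_cmult[symmetric]) (auto intro!: nn_integral_cong simp: indicator_def)
    then show "(\<integral>\<^sup>+x. indicator {0..} t * indicator {(t, x). t < q x} (t, x) \<partial>\<mu>)
      = indicator {0..} t * emeasure \<mu> {x \<in> space \<mu>. t < q x}" by simp
  qed
  finally show ?thesis .
qed

text \<open>The superlevel sets of a nondecreasing q are upper sets, so each level t costs at most
  g. Only levels in \<open>{0..K}\<close> can cost anything, whence the total
  \<open>g * K\<close>.\<close>

lemma integral_mono_fun_le:
  fixes \<mu> \<nu> :: "real measure" and q :: "real \<Rightarrow> real"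
  assumes \<mu>: "prob_space \<mu>" "sets \<mu> = sets borel" and \<nu>: "prob_space \<nu>" "sets \<nu> = sets borel"
    and atomless: "\<And>t. measure \<nu> {t} = 0"
    and tail: "\<And>t. measure \<mu> {t..} \<le> measure \<nu> {t..} + g"
    and g: "0 \<le> g"
    and q: "mono q" "\<And>x. 0 \<le> q x" "\<And>x. q x \<le> K"
  shows "(\<integral>x. q x \<partial>\<mu>) \<le> (\<integral>x. q x \<partial>\<nu>) + g * K"
proof -
  interpret \<mu>: prob_space \<mu> by fact
  interpret \<nu>: prob_space \<nu> by fact
  have sp: "space \<nu> = UNIV" "space \<mu> = UNIV"
    using sets_eq_imp_space_eq[OF \<mu>(2)] sets_eq_imp_space_eq[OF \<nu>(2)] by (metis space_borel)+
  have K: "0 \<le> K" using q(2,3) order_trans by blast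
  have qb[measurable]: "q \<in> borel_measurable borel" by (rule borel_measurable_mono[OF q(1)])
  have [measurable]: "q \<in> borel_measurable \<mu>" "q \<in> borel_measurable \<nu>"
    using qb by (simp_all add: measurable_cong_sets[OF \<mu>(2) refl] measurable_cong_sets[OF \<nu>(2) refl])
  have le: "emeasure \<mu> {x. t < q x} \<le> emeasure \<nu> {x. t < q x} + ennreal g" for t
  proof -
    have "measure \<mu> {x. t < q x} \<le> measure \<nu> {x. t < q x} + g"
    proof (rule upper_set_measure_le[OF \<mu> \<nu> atomless tail g])
      show "y \<in> {x. t < q x}" if "x \<in> {x. t < q x}" "x \<le> y" for x y
        using that monoD[OF q(1), of x y] by auto
    qed measurable
    then show ?thesis
      using g by (simp add: \<mu>.emeasure_eq_measure \<nu>.emeasure_eq_measure flip: ennreal_plus)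
  qed
  have meas: "(\<lambda>t. emeasure \<nu> {x. t < q x}) \<in> borel_measurable borel"
  proof -
    have "Measurable.pred (borel \<Otimes>\<^sub>M \<nu>) (\<lambda>p. fst p < q (snd p))" by measurable
    then have "{p \<in> space (borel \<Otimes>\<^sub>M \<nu>). fst p < q (snd p)} \<in> sets (borel \<Otimes>\<^sub>M \<nu>)" by simp
    from \<nu>.measurable_emeasure_Pair[OF this] show ?thesis
      by (simp add: vimage_def sp space_pair_measure)
  qed
  have "ennreal (\<integral>x. q x \<partial>\<mu>) = (\<integral>\<^sup>+x. ennreal (q x) \<partial>\<mu>)"
    using q(2,3) by (intro nn_integral_eq_integral[symmetric] \<mu>.integrable_const_bound[where B = K]) auto
  also have "\<dots> = (\<integral>\<^sup>+t. indicator {0..} t * emeasure \<mu> {x \<in> space \<mu>. t < q x} \<partial>lborel)"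
    by (rule nn_integral_layer_cake) (auto intro: \<mu>.sigma_finite_measure_axioms)
  also have "\<dots> \<le> (\<integral>\<^sup>+t. indicator {0..} t * emeasure \<nu> {x. t < q x} + ennreal g * indicator {0..K} t \<partial>lborel)"
  proof (rule nn_integral_mono)
    fix t
    have "{x. t < q x} = {}" if "K < t"
      using that q(3) by (auto simp: not_less) (smt (verit))
    then show "indicator {0..} t * emeasure \<mu> {x \<in> space \<mu>. t < q x}
        \<le> indicator {0..} t * emeasure \<nu> {x. t < q x} + ennreal g * indicator {0..K} t"
      using le[of t] by (cases "K < t") (auto simp: indicator_def sp)
  qed
  also have "\<dots> = (\<integral>\<^sup>+t. indicator {0..} t * emeasure \<nu> {x \<in> space \<nu>. t < q x} \<partial>lborel) + ennreal g * ennreal K"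
    using meas K by (subst nn_integral_add) (auto simp: nn_integral_cmult sp)
  also have "(\<integral>\<^sup>+t. indicator {0..} t * emeasure \<nu> {x \<in> space \<nu>. t < q x} \<partial>lborel) = (\<integral>\<^sup>+x. ennreal (q x) \<partial>\<nu>)"
    by (rule nn_integral_layer_cake[symmetric]) (auto intro: \<nu>.sigma_finite_measure_axioms)
  also have "\<dots> = ennreal (\<integral>x. q x \<partial>\<nu>)"
    using q(2,3) by (intro nn_integral_eq_integral \<nu>.integrable_const_bound[where B = K]) auto
  also have "\<dots> + ennreal g * ennreal K = ennreal ((\<integral>x. q x \<partial>\<nu>) + g * K)"
    using g K q(2) by (simp add: ennreal_mult ennreal_plus)
  finally show ?thesis
    using g K q(2) by (subst (asm) ennreal_le_iff) auto
qed

lemma laplace_bound: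
  fixes \<mu> :: "real measure" and \<psi> :: "real \<Rightarrow> real"
  assumes \<mu>: "prob_space \<mu>" "sets \<mu> = sets borel"
    and tail: "\<And>t. measure \<mu> {t..} \<le> measure std_normal_distribution {t..} + g"
    and mono: "mono \<psi>" and bound: "\<And>x. \<bar>\<psi> x\<bar> \<le> 1" and odd: "\<And>x. 0 \<le> \<psi> x + \<psi> (- x)"
    and large: "\<And>x. c < x \<Longrightarrow> 1/2 \<le> \<psi> x" and c: "0 \<le> c"
    and a: "0 < a" and g: "0 \<le> g" and small: "exp (c\<^sup>2) * (a + 2 * g) \<le> 33/100"
    and e: "e = 3 * exp (c\<^sup>2) * (a + 2 * g)"
  shows "(\<integral>w. exp (- (3 * a) * \<psi> (e - w)) \<partial>\<mu>) \<le> exp (- 2 * a\<^sup>2)"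
proof -
  interpret \<mu>: prob_space \<mu> by fact
  interpret N: prob_space std_normal_distribution
    using prob_space_normal_density[of 1 0] by simp
  have [measurable]: "\<psi> \<in> borel_measurable borel" by (rule borel_measurable_mono[OF mono])
  define \<delta> where "\<delta> = a + 2 * g"
  \<comment> \<open>The radius is \<open>e = y\<^sup>2 * (3 * \<delta>)\<close>. The widening by
    \<open>y\<^sup>2\<close> pays for the loss 1 / y in \<open>central_mass_ge\<close>, so the
    numerical inequality no longer involves c.\<close>
  define y where "y = exp (c\<^sup>2 / 2)"
  define l where "l = 3 * a"
  have y: "1 \<le> y" "y\<^sup>2 = exp (c\<^sup>2)"
    by (simp_all add: y_def flip: exp_double)
  have \<delta>: "a \<le> \<delta>" "0 < \<delta>" using a g by (auto simp: \<delta>_def)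
  have "1 * \<delta> \<le> exp (c\<^sup>2) * \<delta>" using \<delta> by (intro mult_right_mono) auto
  then have \<delta>_le: "\<delta> \<le> 33/100" using small by (simp add: \<delta>_def)
  have e': "e = y\<^sup>2 * (3 * \<delta>)" "e \<le> 99/100" "0 < e"
    using small a g by (simp_all add: e \<delta>_def y(2) add_pos_nonneg)
  have "gauss_poly (3 * \<delta>) \<le> exp (- c\<^sup>2 / 2) * gauss_poly e"
  proof -
    have "y * gauss_poly (3 * \<delta>) \<le> gauss_poly e"
      unfolding e'(1) by (rule gauss_poly_scale) (use \<delta> e'(1,2) y in linarith)+
    then have "exp (- c\<^sup>2 / 2) * (y * gauss_poly (3 * \<delta>)) \<le> exp (- c\<^sup>2 / 2) * gauss_poly e"
      by (rule mult_left_mono) simp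
    then show ?thesis by (simp add: y_def flip: mult.assoc exp_add)
  qed
  then have V: "7978/10000 * gauss_poly (3 * \<delta>) \<le> central_mass c e"
    using central_mass_ge[of e c] e' by (simp add: mult.assoc)
  have "3 * a \<le> e" using \<delta> y e'(1) mult_mono[of 1 "y\<^sup>2" "3 * a" "3 * \<delta>"] a by (simp add: power2_eq_square mult_le_one)
  have "gauss_poly (3 * a) \<le> gauss_poly e"
  proof -
    \<comment> \<open>As r >= 1, \<open>gauss_poly_scale\<close> also serves as a monotonicity
      statement for \<open>gauss_poly\<close>.\<close>
    define r where "r = sqrt (e / (3 * a))"
    have r: "1 \<le> r" "r\<^sup>2 * (3 * a) = e"
      using \<open>3 * a \<le> e\<close> a e' by (auto simp: r_def)
    have "0 \<le> gauss_poly (3 * a)"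
      by (rule gauss_poly_nonneg) (use \<open>3 * a \<le> e\<close> e'(2) a in linarith)+
    then have "1 * gauss_poly (3 * a) \<le> r * gauss_poly (3 * a)"
      using r(1) by (rule mult_right_mono[rotated])
    also have "\<dots> \<le> gauss_poly e"
      using gauss_poly_scale[of "3 * a" r] r a e' by simp
    finally show ?thesis by simp
  qed
  then have V0: "tanh (3/4 * l) \<le> central_mass 0 e"
    using tanh_le_gauss_poly[of a] central_mass_ge[of e 0] e' a \<delta> \<delta>_le by (simp add: l_def)
  \<comment> \<open>Subtracting the least possible value \<open>exp (- l)\<close> makes the
    integrand nonnegative with range at most \<open>exp l - exp (- l)\<close>. It increases in w
    because \<psi> is applied to e - w.\<close>
  define q where "q w = exp (- l * \<psi> (e - w)) - exp (- l)" for w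
  have l: "0 < l" using a by (simp add: l_def)
  have lower: "exp (- l) \<le> exp (- l * \<psi> x)" and upper: "exp (- l * \<psi> x) \<le> exp l" for x
    using mult_left_mono[of "\<psi> x" 1 l] mult_left_mono[of "- \<psi> x" 1 l] bound[of x] l by auto
  have "(\<integral>w. q w \<partial>\<mu>) \<le> (\<integral>w. q w \<partial>std_normal_distribution) + g * (exp l - exp (- l))"
  proof (rule integral_mono_fun_le[OF \<mu> N.prob_space_axioms _ _ tail g])
    show "measure std_normal_distribution {t} = 0" for t
    proof -
      have "(\<integral>x. indicator {t} x * std_normal_density x \<partial>lborel) = 0"
      proof (rule integral_eq_zero_AE)
        show "AE x in lborel. indicator {t} x * std_normal_density x = 0"
          using AE_lborel_singleton[of t] by eventually_elim simp
      qed
      then show ?thesis by (simp add: measure_std_normal)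
    qed
    show "mono q"
      unfolding q_def mono_def using l mono
      by (auto intro!: mult_left_mono simp: mono_def)
  qed (use lower upper in \<open>auto simp: q_def\<close>)
  moreover have "(\<integral>w. q w \<partial>\<mu>) = (\<integral>w. exp (- l * \<psi> (e - w)) \<partial>\<mu>) - exp (- l)"
  proof -
    have "(\<lambda>w. exp (- l * \<psi> (e - w))) \<in> borel_measurable \<mu>"
      unfolding measurable_cong_sets[OF \<mu>(2) refl] by measurable
    then have "integrable \<mu> (\<lambda>w. exp (- l * \<psi> (e - w)))"
      using upper by (intro \<mu>.integrable_const_bound[where B = "exp l"]) auto
    then show ?thesis by (simp add: q_def \<mu>.prob_space)
  qed
  moreover have "(\<integral>w. q w \<partial>std_normal_distribution)
      = (\<integral>w. exp (- l * \<psi> (e - w)) \<partial>std_normal_distribution) - exp (- l)"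
  proof -
    have "integrable std_normal_distribution (\<lambda>w. exp (- l * \<psi> (e - w)))"
      using upper by (intro N.integrable_const_bound[where B = "exp l"]) auto
    then show ?thesis using N.prob_space by (simp add: q_def)
  qed
  moreover have "(\<integral>w. exp (- l * \<psi> (e - w)) \<partial>std_normal_distribution)
      = (\<integral>z. exp (- l * \<psi> (e - z)) * std_normal_density z \<partial>lborel)"
    by (subst integral_density) (auto simp: mult.commute)
  ultimately have "(\<integral>w. exp (- l * \<psi> (e - w)) \<partial>\<mu>)
      \<le> (\<integral>z. exp (- l * \<psi> (e - z)) * std_normal_density z \<partial>lborel) + g * (exp l - exp (- l))"
    by simp
  also have "\<dots> \<le> cosh (l / 2) - sinh (l / 2) * central_mass c e + g * (exp l - exp (- l))"
    using gaussian_laplace_bound[OF mono bound odd large c \<open>0 < e\<close> l V0] by simp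
  also have "\<dots> \<le> cosh (l / 2) - sinh (l / 2) * (7978/10000 * gauss_poly (3 * \<delta>)) + g * (exp l - exp (- l))"
    using V l by (auto intro!: mult_left_mono)
  \<comment> \<open>The approximation error acquires the form used in
    \<open>chernoff_numeric\<close>, since 2 g = \<delta> - a and sinh l = 2 sinh (l/2) cosh
    (l/2).\<close>
  also have "g * (exp l - exp (- l)) = 2 * (\<delta> - a) * (sinh (l / 2) * cosh (l / 2))"
  proof -
    have "exp l - exp (- l) = 2 * sinh (2 * (l / 2))" by (simp add: sinh_def)
    then show ?thesis unfolding sinh_double by (simp add: \<delta>_def)
  qed
  also have "cosh (l / 2) - sinh (l / 2) * (7978/10000 * gauss_poly (3 * \<delta>)) + 2 * (\<delta> - a) * (sinh (l / 2) * cosh (l / 2))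
      = cosh (3/2 * a) - sinh (3/2 * a) * (7978/10000 * gauss_poly (3 * \<delta>) - 2 * (\<delta> - a) * cosh (3/2 * a))"
    by (simp add: l_def algebra_simps)
  also have "\<dots> \<le> exp (- 2 * a\<^sup>2)"
    using a \<delta> \<delta>_le by (intro chernoff_numeric) auto
  finally show ?thesis by (simp add: l_def)
qed

text \<open>Chernoff's method: Markov's inequality for \<open>exp (- l * sum)\<close>, whose
  expectation factors by independence. Boundedness of the variables provides integrability.\<close>

lemma (in prob_space) prob_sum_nonpos_le:
  fixes Y :: "'i \<Rightarrow> 'a \<Rightarrow> real"
  assumes J: "finite J" and indep: "indep_vars (\<lambda>_. borel) Y J"
    and bound: "\<And>j x. j \<in> J \<Longrightarrow> \<bar>Y j x\<bar> \<le> B"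
    and l: "0 \<le> l" and laplace: "\<And>j. j \<in> J \<Longrightarrow> expectation (\<lambda>x. exp (- l * Y j x)) \<le> m"
  shows "prob {x \<in> space M. (\<Sum>j\<in>J. Y j x) \<le> 0} \<le> m ^ card J"
proof -
  have [measurable]: "Y j \<in> borel_measurable M" if "j \<in> J" for j
    using indep that by (auto simp: indep_vars_def)
  have int: "integrable M (\<lambda>x. exp (- l * Y j x))" if "j \<in> J" for j
  proof (rule integrable_const_bound[where B = "exp (l * B)"])
    show "AE x in M. norm (exp (- l * Y j x)) \<le> exp (l * B)"
      using mult_left_mono[of "- Y j x" B l for x] bound[OF that] l by (auto simp: abs_le_iff)
  qed (use that in measurable)
  have ind: "indep_vars (\<lambda>_. borel) (\<lambda>j x. exp (- l * Y j x)) J"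
    by (rule indep_vars_compose2[OF indep]) auto
  have prod: "exp (- l * (\<Sum>j\<in>J. Y j x)) = (\<Prod>j\<in>J. exp (- l * Y j x))" for x
    by (simp add: exp_sum[OF J] sum_distrib_left flip: sum_negf)
  have "prob {x \<in> space M. (\<Sum>j\<in>J. Y j x) \<le> 0} \<le> prob {x \<in> space M. 1 \<le> exp (- l * (\<Sum>j\<in>J. Y j x))}"
    using l J by (intro finite_measure_mono) (auto simp: mult_nonneg_nonpos)
  also have "\<dots> \<le> expectation (\<lambda>x. exp (- l * (\<Sum>j\<in>J. Y j x))) / 1"
    unfolding prod using indep_vars_integrable[OF J ind int]
    by (intro integral_Markov_inequality_measure[where A = "{}"]) (auto intro!: prod_nonneg)
  also have "\<dots> = (\<Prod>j\<in>J. expectation (\<lambda>x. exp (- l * Y j x)))"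
    unfolding prod using indep_vars_lebesgue_integral[OF J ind int] by simp
  also have "\<dots> \<le> (\<Prod>j\<in>J. m)"
    using laplace by (intro prod_mono) auto
  finally show ?thesis by simp
qed

section \<open>One-sided derivatives of even convex functions\<close>

text \<open>The difference quotients from x decrease as t tends to x from the right and are bounded
  below by the slope to x - 1. They converge to their infimum, which is the right derivative and
  also the slope of a supporting line.\<close>

lemma
  fixes f :: "real \<Rightarrow> real"
  assumes f: "convex_on UNIV f"
  shows right_deriv_convex: "(f has_real_derivative right_deriv f x) (at_right x)"
    and right_deriv_subgradient: "f x + right_deriv f x * (y - x) \<le> f y"
proof -
  define S where "S t = (f x - f t) / (x - t)" for t
  define D where "D = Inf (S ` {x<..})"
  have lower: "(f (x - 1) - f x) / (x - 1 - x) \<le> S t" if "x < t" for t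
    using convex_on_slope_le[OF f, of "x - 1" t x] that unfolding S_def by simp
  have bdd: "bdd_below (S ` {x<..})"
    by (rule bdd_belowI2[where m = "(f (x - 1) - f x) / (x - 1 - x)"]) (use lower in auto)
  have S_mono: "S t \<le> S t'" if "x < t" "t \<le> t'" for t t'
    using convex_on_slope_le(1)[OF f, of x t' t] that unfolding S_def by (cases "t = t'") auto
  have D_le: "D \<le> S t" if "x < t" for t
    unfolding D_def using that bdd by (intro cInf_lower) auto
  have "(S \<longlongrightarrow> D) (at_right x)"
  proof (rule order_tendstoI)
    fix b assume "b < D"
    then show "eventually (\<lambda>t. b < S t) (at_right x)"
      unfolding eventually_at_right_field using D_le by (intro exI[of _ "x + 1"]) (auto intro: less_le_trans)
  next
    fix b assume "D < b"
    moreover have "S ` {x<..} \<noteq> {}" by auto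
    ultimately obtain t where t: "x < t" "S t < b"
      unfolding D_def using bdd by (auto simp: cInf_less_iff)
    then show "eventually (\<lambda>t. S t < b) (at_right x)"
      unfolding eventually_at_right_field using S_mono by (intro exI[of _ t]) (auto intro: le_less_trans less_imp_le)
  qed
  moreover have "S = (\<lambda>t. (f t - f x) / (t - x))"
    using minus_divide_divide[of "f x - f t" "x - t" for t] by (simp add: S_def fun_eq_iff)
  ultimately have der: "(f has_real_derivative D) (at_right x)"
    by (simp add: has_field_derivative_iff)
  have "right_deriv f x = D"
    unfolding right_deriv_def
  proof (rule the_equality)
    show "(f has_real_derivative D) (at_right x)" by (rule der)
    fix D' assume "(f has_real_derivative D') (at_right x)"
    with der show "D' = D"
      unfolding has_field_derivative_iff by (rule tendsto_unique[OF trivial_limit_at_right_real, rotated -1])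
  qed
  then show "(f has_real_derivative right_deriv f x) (at_right x)" using der by simp
  have "f x + D * (y - x) \<le> f y"
    using convex_le_Inf_differential[OF f, of x y] by (simp add: D_def S_def image_def)
  then show "f x + right_deriv f x * (y - x) \<le> f y"
    using \<open>right_deriv f x = D\<close> by simp
qed

lemma right_deriv_mono:
  fixes f :: "real \<Rightarrow> real"
  assumes f: "convex_on UNIV f"
  shows "mono (right_deriv f)"
proof
  fix x y :: real assume "x \<le> y"
  show "right_deriv f x \<le> right_deriv f y"
  proof (cases "x = y")
    case False
    have "right_deriv f x * (y - x) \<le> right_deriv f y * (y - x)"
      using right_deriv_subgradient[OF f, of x y] right_deriv_subgradient[OF f, of y x] by (simp add: algebra_simps)
    then show ?thesis using False \<open>x \<le> y\<close> by (simp add: mult_le_cancel_right)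
  qed simp
qed

text \<open>By evenness, - \<open>right_deriv f (- x)\<close> is the left derivative at x, which is
  at most the right one. The inequality is strict at a kink, so the right derivative is odd only up
  to jumps.\<close>

lemma right_deriv_reflect:
  fixes f :: "real \<Rightarrow> real"
  assumes f: "convex_on UNIV f" and even: "\<And>x. f (- x) = f x"
  shows "0 \<le> right_deriv f x + right_deriv f (- x)"
proof -
  have "((\<lambda>y. (f y - f (- x)) / (y - (- x))) \<longlongrightarrow> right_deriv f (- x)) (at_right (- x))"
    using right_deriv_convex[OF f, of "- x"] by (simp add: has_field_derivative_iff)
  then have "- right_deriv f x \<le> right_deriv f (- x)"
  proof (rule tendsto_lowerbound)
    have "- right_deriv f x \<le> (f y - f (- x)) / (y - (- x))" if "- x < y" for y
      using right_deriv_subgradient[OF f, of x "- y"] that even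
      by (simp add: pos_le_divide_eq algebra_simps)
    then show "eventually (\<lambda>y. - right_deriv f x \<le> (f y - f (- x)) / (y - (- x))) (at_right (- x))"
      by (intro eventually_at_right_less[THEN eventually_mono]) auto
  qed simp
  then show ?thesis by simp
qed

lemma left_deriv_reflect:
  fixes f :: "real \<Rightarrow> real"
  assumes f: "convex_on UNIV f" and even: "\<And>x. f (- x) = f x"
  shows "left_deriv f x = - right_deriv f (- x)"
  unfolding left_deriv_def
proof (rule the_equality)
  have "((\<lambda>y. (f y - f (- x)) / (y - (- x))) \<longlongrightarrow> right_deriv f (- x)) (at_right (- x))"
    using right_deriv_convex[OF f, of "- x"] by (simp add: has_field_derivative_iff)
  then have "((\<lambda>y. (f (- y) - f (- x)) / (- y - (- x))) \<longlongrightarrow> right_deriv f (- x)) (at_left x)"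
    by (simp add: at_right_minus[of "- x"] filterlim_filtermap)
  then have "((\<lambda>y. - ((f (- y) - f (- x)) / (- y - (- x)))) \<longlongrightarrow> - right_deriv f (- x)) (at_left x)"
    by (rule tendsto_minus)
  moreover have "- ((f (- y) - f (- x)) / (- y - (- x))) = (f y - f x) / (y - x)" for y
    by (simp add: even flip: divide_minus_right)
  ultimately show *: "(f has_real_derivative - right_deriv f (- x)) (at_left x)"
    by (simp add: has_field_derivative_iff)
  fix D assume "(f has_real_derivative D) (at_left x)"
  with * show "D = - right_deriv f (- x)"
    unfolding has_field_derivative_iff by (rule tendsto_unique[OF trivial_limit_at_left_real, rotated -1])
qed

section \<open>From essential bounds to bounds at every point\<close>

lemma exists_between_of_AE:
  fixes x y :: real
  assumes "AE z in lborel. Q z" "x < y"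
  shows "\<exists>z. x < z \<and> z < y \<and> Q z"
proof (rule ccontr)
  assume "\<not> ?thesis"
  with assms(1) have "AE z in lborel. z \<notin> {x<..<y}"
    by (auto elim!: eventually_mono)
  then have "emeasure lborel {x<..<y} = 0"
    by (subst (asm) AE_iff_measurable[of "{x<..<y}"]) auto
  with assms(2) show False by simp
qed

text \<open>Finiteness is assumed for the averaged derivative, while C refers to the norm of the
  right derivative. The two functions interlace: for x < y, each of them at x is at most the other
  at y. An almost everywhere bound on one therefore bounds the right derivative at every
  point.\<close>

lemma right_deriv_normalization:
  fixes f :: "real \<Rightarrow> real"
  assumes f: "convex_on UNIV f" and even: "\<And>x. f (- x) = f x"
    and infinity: "filterlim f at_top at_infinity"
    and fin: "Linf_norm (avg_deriv f) < \<infinity>"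
  obtains L where "0 < L" "Linf_norm (right_deriv f) = ereal L" "\<And>x. \<bar>right_deriv f x\<bar> \<le> L"
proof -
  let ?r = "right_deriv f"
  note mono = monoD[OF right_deriv_mono[OF f]]
  have bound_of_AE: "\<bar>?r x\<bar> \<le> K"
    if AE: "AE y in lborel. \<bar>h y\<bar> \<le> K" and h: "\<And>x y. x < y \<Longrightarrow> ?r x \<le> h y \<and> h x \<le> ?r y"
    for h K x
  proof -
    obtain y where "x < y" "\<bar>h y\<bar> \<le> K" using exists_between_of_AE[OF AE, of x "x + 1"] by auto
    moreover obtain z where "z < x" "\<bar>h z\<bar> \<le> K" using exists_between_of_AE[OF AE, of "x - 1" x] by auto
    ultimately show ?thesis using h[of x y] h[of z x] by auto
  qed
  have avg: "?r x \<le> avg_deriv f y \<and> avg_deriv f x \<le> ?r y" if "x < y" for x y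
  proof -
    have le: "?r x \<le> - ?r (- y)"
    proof -
      have "?r x * (y - x) \<le> - ?r (- y) * (y - x)"
        using right_deriv_subgradient[OF f, of x y] right_deriv_subgradient[OF f, of "- y" "- x"]
        by (simp add: even algebra_simps)
      then show ?thesis by (rule mult_right_le_imp_le) (use that in simp)
    qed
    have "- ?r (- x) \<le> ?r x" using right_deriv_reflect[OF f even, of x] by simp
    then show ?thesis
      using le mono[of x y] that by (simp add: avg_deriv_def left_deriv_reflect[OF f even])
  qed
  have rm[measurable]: "?r \<in> borel_measurable borel"
    by (rule borel_measurable_mono[OF right_deriv_mono[OF f]])
  have nontriv: "emeasure (lborel :: real measure) (space lborel) \<noteq> 0" by simp
  obtain K where K: "\<And>x. \<bar>?r x\<bar> \<le> K"
  proof (cases "Linf_norm (avg_deriv f)")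
    case (real K)
    then have "AE y in lborel. \<bar>avg_deriv f y\<bar> \<le> K"
      using esssup_AE[of "\<lambda>x. ereal \<bar>avg_deriv f x\<bar>" lborel] by (simp add: Linf_norm_def)
    then have "\<bar>?r x\<bar> \<le> K" for x using bound_of_AE[OF _ avg] by simp
    then show ?thesis by (rule that)
  next
    \<comment> \<open>An essential supremum of minus infinity would make an absurd statement true
      almost everywhere, although Lebesgue measure is not zero.\<close>
    case MInf
    then have "AE y in (lborel :: real measure). False"
      using esssup_AE[of "\<lambda>x. ereal \<bar>avg_deriv f x\<bar>" lborel] by (simp add: Linf_norm_def)
    then show ?thesis using nontriv by (simp add: AE_iff_measurable[OF _ refl])
  qed (use fin in auto)
  have "Linf_norm ?r \<le> ereal K"
    unfolding Linf_norm_def by (intro esssup_I) (use K in auto)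
  moreover have "Linf_norm ?r \<noteq> - \<infinity>"
  proof
    assume "Linf_norm ?r = - \<infinity>"
    then have "AE y in (lborel :: real measure). False"
      using esssup_AE[of "\<lambda>x. ereal \<bar>?r x\<bar>" lborel] by (simp add: Linf_norm_def)
    then show False using nontriv by (simp add: AE_iff_measurable[OF _ refl])
  qed
  ultimately obtain L where L: "Linf_norm ?r = ereal L"
    by (cases "Linf_norm ?r") auto
  have "AE y in lborel. \<bar>?r y\<bar> \<le> L"
    using esssup_AE[of "\<lambda>x. ereal \<bar>?r x\<bar>" lborel] L by (simp add: Linf_norm_def)
  then have L_bound: "\<bar>?r x\<bar> \<le> L" for x
    using bound_of_AE[of ?r L x] mono by (auto simp: less_imp_le)
  have "L \<noteq> 0"
  proof
    assume "L = 0"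
    then have "?r x = 0" for x using L_bound[of x] by simp
    \<comment> \<open>A vanishing right derivative makes every point a minimizer, which contradicts
      the growth of f at infinity.\<close>
    then have "f y \<le> f 0" for y
      using right_deriv_subgradient[OF f, of y 0] by simp
    moreover have "eventually (\<lambda>y. f 0 < f y) at_infinity"
      using infinity by (simp add: filterlim_at_top_dense)
    ultimately have "eventually (\<lambda>y :: real. False) at_infinity"
      by (elim eventually_mono) (metis not_less)
    then show False by (simp add: eventually_False trivial_limit_at_infinity)
  qed
  moreover have "0 \<le> L" using L_bound[of 0] by simp
  ultimately show ?thesis using that L L_bound by simp
qed

text \<open>The sum of the right derivatives is a subgradient of the objective at z. If it is
  positive, the objective exceeds its value at z everywhere to the right of z, so no minimizer lies
  there.\<close>

lemma minimizer_le:
  fixes f :: "real \<Rightarrow> real" and t :: "'i \<Rightarrow> real"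
  assumes f: "convex_on UNIV f"
    and pos: "0 < (\<Sum>j\<in>J. right_deriv f (z - t j))"
    and min: "(\<Sum>j\<in>J. f (x - t j)) \<le> (\<Sum>j\<in>J. f (z - t j))"
  shows "x \<le> z"
proof (rule ccontr)
  assume "\<not> x \<le> z"
  then have "0 < (\<Sum>j\<in>J. right_deriv f (z - t j)) * (x - z)" using pos by simp
  moreover have "(\<Sum>j\<in>J. f (z - t j) + right_deriv f (z - t j) * (x - z)) \<le> (\<Sum>j\<in>J. f (x - t j))"
    using right_deriv_subgradient[OF f, of "z - t j" "x - t j" for j] by (intro sum_mono) (simp add: algebra_simps)
  ultimately show False using min by (simp add: sum.distrib sum_distrib_right)
qed

section \<open>The law of the estimators\<close>

lemma (in prob_space) distr_iid:
  assumes I: "finite I" and indep: "indep_vars (\<lambda>_. P) X I" and X: "\<And>l. l \<in> I \<Longrightarrow> distr M P (X l) = P"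
  shows "distr M (\<Pi>\<^sub>M l\<in>I. P) (\<lambda>\<omega>. \<lambda>l\<in>I. X l \<omega>) = (\<Pi>\<^sub>M l\<in>I. P)"
proof (cases "I = {}")
  \<comment> \<open>Over no indices the product is a one-point space, so both measures give mass 1
    to its only nonempty event.\<close>
  case True
  have meas: "(\<lambda>\<omega>. \<lambda>l\<in>{}. X l \<omega>) \<in> M \<rightarrow>\<^sub>M (\<Pi>\<^sub>M l\<in>{}. P)"
    by (rule measurable_restrict) simp
  interpret D: prob_space "distr M (\<Pi>\<^sub>M l\<in>{}. P) (\<lambda>\<omega>. \<lambda>l\<in>{}. X l \<omega>)"
    by (rule prob_space_distr[OF meas])
  show ?thesis
    unfolding True
  proof (rule measure_eqI)
    fix A assume A: "A \<in> sets (distr M (\<Pi>\<^sub>M l\<in>{}. P) (\<lambda>\<omega>. \<lambda>l\<in>{}. X l \<omega>))"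
    then have "A = {} \<or> A = {\<lambda>_. undefined}" by (auto simp: PiM_empty)
    then show "emeasure (distr M (\<Pi>\<^sub>M l\<in>{}. P) (\<lambda>\<omega>. \<lambda>l\<in>{}. X l \<omega>)) A = emeasure (\<Pi>\<^sub>M l\<in>{}. P) A"
      using D.emeasure_space_1 by (auto simp: PiM_empty space_PiM)
  qed simp
next
  case False
  have "distr M (\<Pi>\<^sub>M l\<in>I. P) (\<lambda>\<omega>. \<lambda>l\<in>I. X l \<omega>) = (\<Pi>\<^sub>M l\<in>I. distr M P (X l))"
    using indep_vars_iff_distr_eq_PiM'[of I X "\<lambda>_. P"] indep False by (auto simp: indep_vars_def)
  also have "\<dots> = (\<Pi>\<^sub>M l\<in>I. P)" by (intro PiM_cong refl X)
  finally show ?thesis .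
qed

text \<open>For a fixed group, the sample is a function of the joint vector of observations, so
  events about it belong to the sigma-algebra generated by that vector.\<close>

lemma group_sample_restrict:
  assumes "finite A" "A \<subseteq> I"
  shows "group_sample X A \<omega> = (\<lambda>l\<in>{..<card A}. (\<lambda>l\<in>I. X l \<omega>) (sorted_list_of_set A ! l))"
proof -
  have "sorted_list_of_set A ! l \<in> I" if "l < card A" for l
    using assms nth_mem[of l "sorted_list_of_set A"] that by auto
  then show ?thesis by (auto simp: group_sample_def fun_eq_iff)
qed

text \<open>The increasing enumeration of A is injective, and reindexing a product of equal factors
  along an injection gives a product of the same factor.\<close>

lemma (in prob_space) distr_group_sample:
  assumes P: "prob_space P"
    and I: "finite I" and indep: "indep_vars (\<lambda>_. P) X I" and X: "\<And>l. l \<in> I \<Longrightarrow> distr M P (X l) = P"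
    and A: "A \<subseteq> I"
  shows "distr M (\<Pi>\<^sub>M l\<in>{..<card A}. P) (group_sample X A) = (\<Pi>\<^sub>M l\<in>{..<card A}. P)"
    and "group_sample X A \<in> M \<rightarrow>\<^sub>M (\<Pi>\<^sub>M l\<in>{..<card A}. P)"
proof -
  let ?s = "\<lambda>l. sorted_list_of_set A ! l"
  have finA: "finite A" using A I finite_subset by blast
  have inj: "inj_on ?s {..<card A}"
    by (auto simp: inj_on_def nth_eq_iff_index_eq finA)
  have into: "?s \<in> {..<card A} \<rightarrow> I"
    using A finA nth_mem[of _ "sorted_list_of_set A"] by auto
  have meas[measurable]: "(\<lambda>\<omega>. \<lambda>l\<in>I. X l \<omega>) \<in> M \<rightarrow>\<^sub>M (\<Pi>\<^sub>M l\<in>I. P)"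
    using indep by (auto intro!: measurable_restrict simp: indep_vars_def)
  have meas': "(\<lambda>x. \<lambda>l\<in>{..<card A}. x (?s l)) \<in> (\<Pi>\<^sub>M l\<in>I. P) \<rightarrow>\<^sub>M (\<Pi>\<^sub>M l\<in>{..<card A}. P)"
    using into by (intro measurable_restrict measurable_component_singleton) auto
  have eq: "group_sample X A = (\<lambda>x. \<lambda>l\<in>{..<card A}. x (?s l)) \<circ> (\<lambda>\<omega>. \<lambda>l\<in>I. X l \<omega>)"
    using group_sample_restrict[OF finA A, of X] by (simp add: fun_eq_iff)
  show "group_sample X A \<in> M \<rightarrow>\<^sub>M (\<Pi>\<^sub>M l\<in>{..<card A}. P)"
    unfolding eq by (rule measurable_comp[OF meas meas'])
  have "distr M (\<Pi>\<^sub>M l\<in>{..<card A}. P) (group_sample X A)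
      = distr (distr M (\<Pi>\<^sub>M l\<in>I. P) (\<lambda>\<omega>. \<lambda>l\<in>I. X l \<omega>)) (\<Pi>\<^sub>M l\<in>{..<card A}. P) (\<lambda>x. \<lambda>l\<in>{..<card A}. x (?s l))"
    unfolding eq by (rule distr_distr[OF meas' meas, symmetric])
  also have "\<dots> = (\<Pi>\<^sub>M l\<in>{..<card A}. P)"
    using distr_PiM_reindex[of I "\<lambda>_. P" ?s "{..<card A}"] P inj into by (simp add: distr_iid[OF I indep X])
  finally show "distr M (\<Pi>\<^sub>M l\<in>{..<card A}. P) (group_sample X A) = (\<Pi>\<^sub>M l\<in>{..<card A}. P)" .
qed

text \<open>The space is split according to the finitely many values A of the random group. On each
  piece, independence separates the choice \<open>E A\<close> from the data event
  \<open>F A\<close>. The latter has the same probability q for every A, so the total is q.\<close>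

lemma (in prob_space) distr_random_group:
  fixes t :: "(nat \<Rightarrow> 'b) \<Rightarrow> 'c :: topological_space"
  assumes P: "prob_space P"
    and I: "finite I" and indep: "indep_vars (\<lambda>_. P) X I" and X: "\<And>l. l \<in> I \<Longrightarrow> distr M P (X l) = P"
    and j: "j \<in> J" and G: "\<And>i \<omega>. i \<in> J \<Longrightarrow> \<omega> \<in> space M \<Longrightarrow> G i \<omega> \<subseteq> I"
    and card: "\<And>\<omega>. \<omega> \<in> space M \<Longrightarrow> card (G j \<omega>) = n"
    and G_indep: "indep_set
          (sets (vimage_algebra (space M) (\<lambda>\<omega>. \<lambda>j\<in>J. G j \<omega>) (\<Pi>\<^sub>M j\<in>J. count_space (Pow I))))
          (sets (vimage_algebra (space M) (\<lambda>\<omega>. \<lambda>l\<in>I. X l \<omega>) (\<Pi>\<^sub>M l\<in>I. P)))"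
    and t: "t \<in> borel_measurable (\<Pi>\<^sub>M l\<in>{..<n}. P)"
    and Y: "Y \<in> borel_measurable M" "\<And>\<omega>. \<omega> \<in> space M \<Longrightarrow> Y \<omega> = t (group_sample X (G j \<omega>) \<omega>)"
  shows "distr M borel Y = distr (\<Pi>\<^sub>M l\<in>{..<n}. P) borel t"
proof (rule measure_eqI)
  fix B assume "B \<in> sets (distr M borel Y)"
  then have B: "B \<in> sets borel" by simp
  interpret PP: prob_space "\<Pi>\<^sub>M l\<in>{..<n}. P" by (intro prob_space_PiM P)
  define q where "q = measure (\<Pi>\<^sub>M l\<in>{..<n}. P) (t -` B \<inter> space (\<Pi>\<^sub>M l\<in>{..<n}. P))"
  define \<A> where "\<A> = {A. A \<subseteq> I \<and> card A = n}"
  define E where "E A = {\<omega> \<in> space M. G j \<omega> = A}" for A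
  define F where "F A = group_sample X A -` (t -` B \<inter> space (\<Pi>\<^sub>M l\<in>{..<n}. P)) \<inter> space M" for A
  have fin: "finite \<A>" unfolding \<A>_def using I by simp
  have tB: "t -` B \<inter> space (\<Pi>\<^sub>M l\<in>{..<n}. P) \<in> sets (\<Pi>\<^sub>M l\<in>{..<n}. P)"
    using measurable_sets[OF t B] .
  have E_alg: "E A \<in> sets (vimage_algebra (space M) (\<lambda>\<omega>. \<lambda>j\<in>J. G j \<omega>) (\<Pi>\<^sub>M j\<in>J. count_space (Pow I)))"
    if "A \<in> \<A>" for A
  proof -
    have "(\<lambda>f. f j) -` {A} \<inter> space (\<Pi>\<^sub>M j\<in>J. count_space (Pow I)) \<in> sets (\<Pi>\<^sub>M j\<in>J. count_space (Pow I))"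
      using that j by (intro measurable_sets[OF measurable_component_singleton]) (auto simp: \<A>_def)
    from in_vimage_algebra[OF this, of "\<lambda>\<omega>. \<lambda>j\<in>J. G j \<omega>" "space M"]
    show ?thesis
      using j G by (auto simp: E_def space_PiM vimage_def Int_def PiE_iff conj_commute cong: conj_cong elim!: back_subst[where P = "\<lambda>S. S \<in> _"])
  qed
  have F_alg: "F A \<in> sets (vimage_algebra (space M) (\<lambda>\<omega>. \<lambda>l\<in>I. X l \<omega>) (\<Pi>\<^sub>M l\<in>I. P))"
    if A: "A \<in> \<A>" for A
  proof -
    let ?r = "\<lambda>x. \<lambda>l\<in>{..<card A}. x (sorted_list_of_set A ! l)"
    have finA: "finite A" "A \<subseteq> I" "card A = n" using A I finite_subset by (auto simp: \<A>_def)
    have r: "?r \<in> (\<Pi>\<^sub>M l\<in>I. P) \<rightarrow>\<^sub>M (\<Pi>\<^sub>M l\<in>{..<n}. P)"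
      using finA nth_mem[of _ "sorted_list_of_set A"]
      by (auto intro!: measurable_restrict measurable_component_singleton)
    have Xs: "(\<lambda>l\<in>I. X l \<omega>) \<in> space (\<Pi>\<^sub>M l\<in>I. P)" if "\<omega> \<in> space M" for \<omega>
      using indep that by (auto simp: indep_vars_def space_PiM measurable_space)
    have "F A = (\<lambda>\<omega>. \<lambda>l\<in>I. X l \<omega>) -` (?r -` (t -` B \<inter> space (\<Pi>\<^sub>M l\<in>{..<n}. P)) \<inter> space (\<Pi>\<^sub>M l\<in>I. P)) \<inter> space M"
      unfolding F_def using group_sample_restrict[OF finA(1,2), of X] Xs by auto
    also have "\<dots> \<in> sets (vimage_algebra (space M) (\<lambda>\<omega>. \<lambda>l\<in>I. X l \<omega>) (\<Pi>\<^sub>M l\<in>I. P))"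
      by (intro in_vimage_algebra measurable_sets[OF r tB])
    finally show ?thesis .
  qed
  have ev: "E A \<in> events" "F A \<in> events" if "A \<in> \<A>" for A
    using indep_setD_ev1[OF G_indep] indep_setD_ev2[OF G_indep] E_alg[OF that] F_alg[OF that] by auto
  have prob_F: "prob (F A) = q" if "A \<in> \<A>" for A
  proof -
    have A: "A \<subseteq> I" "card A = n" using that by (auto simp: \<A>_def)
    have "q = measure (distr M (\<Pi>\<^sub>M l\<in>{..<n}. P) (group_sample X A)) (t -` B \<inter> space (\<Pi>\<^sub>M l\<in>{..<n}. P))"
      using distr_group_sample(1)[OF P I indep X A(1)] A by (simp add: q_def)
    also have "\<dots> = prob (F A)"
      unfolding F_def using distr_group_sample(2)[OF P I indep X A(1)] A tB by (intro measure_distr) auto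
    finally show ?thesis by simp
  qed
  have in\<A>: "G j \<omega> \<in> \<A>" if "\<omega> \<in> space M" for \<omega>
    using G[OF j that] card[OF that] by (simp add: \<A>_def)
  have "measure (distr M borel Y) B = prob (Y -` B \<inter> space M)"
    by (rule measure_distr[OF Y(1) B])
  also have "Y -` B \<inter> space M = (\<Union>A\<in>\<A>. E A \<inter> F A)"
  proof -
    have "group_sample X (G j \<omega>) \<omega> \<in> space (\<Pi>\<^sub>M l\<in>{..<n}. P)" if "\<omega> \<in> space M" for \<omega>
      using measurable_space[OF distr_group_sample(2)[OF P I indep X G[OF j that]] that] card[OF that] by simp
    then show ?thesis using in\<A> Y(2) by (auto simp: E_def F_def)
  qed
  also have "prob \<dots> = (\<Sum>A\<in>\<A>. prob (E A \<inter> F A))"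
    using ev fin by (intro finite_measure_finite_Union) (auto simp: disjoint_family_on_def E_def)
  also have "\<dots> = (\<Sum>A\<in>\<A>. prob (E A) * q)"
    using indep_setD[OF G_indep E_alg F_alg] prob_F by (intro sum.cong) auto
  also have "\<dots> = prob (\<Union>A\<in>\<A>. E A) * q"
    using ev fin by (subst finite_measure_finite_Union) (auto simp: disjoint_family_on_def E_def sum_distrib_right)
  also have "(\<Union>A\<in>\<A>. E A) = space M" using in\<A> by (auto simp: E_def)
  also have "prob (space M) * q = measure (distr (\<Pi>\<^sub>M l\<in>{..<n}. P) borel t) B"
    using measure_distr[OF t B] by (simp add: prob_space q_def)
  finally have "measure (distr M borel Y) B = measure (distr (\<Pi>\<^sub>M l\<in>{..<n}. P) borel t) B" .
  moreover have "finite_measure (distr M borel Y)" "finite_measure (distr (\<Pi>\<^sub>M l\<in>{..<n}. P) borel t)"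
    using prob_space_distr[OF Y(1)] PP.prob_space_distr[OF t] by (simp_all add: prob_space_def)
  ultimately show "emeasure (distr M borel Y) B = emeasure (distr (\<Pi>\<^sub>M l\<in>{..<n}. P) borel t) B"
    by (simp add: finite_measure.emeasure_eq_measure)
qed simp

section \<open>The deviation bound\<close>

lemma std_normal_reflect: "measure std_normal_distribution {.. - t} = measure std_normal_distribution {t..}"
  using lborel_integral_real_affine[of "-1" "\<lambda>x. indicator {.. - t} x * std_normal_density x" 0]
  by (simp add: measure_std_normal std_normal_density_minus indicator_def cong: if_cong)

text \<open>Distribution functions control lower rays directly, which settles the second bound after
  reflecting the normal law. For the closed upper ray, the complement \<open>{..<t}\<close> is
  reached through the left limit of the normal distribution function.\<close>

lemma tail_le_of_cdf_close:
  fixes \<mu> :: "real measure"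
  assumes \<mu>: "prob_space \<mu>" "sets \<mu> = sets borel"
    and close: "\<And>t. \<bar>cdf \<mu> t - cdf std_normal_distribution t\<bar> \<le> g"
  shows "measure \<mu> {t..} \<le> measure std_normal_distribution {t..} + g"
    and "measure \<mu> {.. - t} \<le> measure std_normal_distribution {t..} + g"
proof -
  interpret \<mu>: prob_space \<mu> by fact
  interpret N: real_distribution std_normal_distribution by (rule real_dist_normal_dist)
  have sp: "space \<mu> = UNIV" using sets_eq_imp_space_eq[OF \<mu>(2)] by (metis space_borel)
  show "measure \<mu> {.. - t} \<le> measure std_normal_distribution {t..} + g"
    using close[of "- t"] std_normal_reflect[of t] by (simp add: cdf_def)
  have "measure std_normal_distribution {..<t} \<le> measure \<mu> {..<t} + g"
  proof (rule tendsto_upperbound[OF N.cdf_at_left])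
    have "cdf std_normal_distribution r \<le> measure \<mu> {..<t} + g" if "r < t" for r
    proof -
      have "cdf \<mu> r \<le> measure \<mu> {..<t}"
        unfolding cdf_def using that \<mu>(2) by (intro \<mu>.finite_measure_mono) auto
      then show ?thesis using close[of r] by linarith
    qed
    then show "eventually (\<lambda>r. cdf std_normal_distribution r \<le> measure \<mu> {..<t} + g) (at_left t)"
      unfolding eventually_at_left_field by (intro exI[of _ "t - 1"]) auto
  qed simp
  moreover have "measure \<mu> {t..} = 1 - measure \<mu> {..<t}"
    using \<mu>.prob_compl[of "{..<t}"] \<mu>(2) by (simp add: sp Compl_eq_Diff_UNIV[symmetric])
  moreover have "measure std_normal_distribution {t..} = 1 - measure std_normal_distribution {..<t}"
    using N.prob_compl[of "{..<t}"] by (simp add: Compl_eq_Diff_UNIV[symmetric])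
  ultimately show "measure \<mu> {t..} \<le> measure std_normal_distribution {t..} + g" by linarith
qed

lemma normal_approx_error_ge:
  fixes P :: "'b measure" and T :: "nat \<Rightarrow> nat \<Rightarrow> (nat \<Rightarrow> 'b) \<Rightarrow> real ^ 'm"
  assumes P: "prob_space P"
  shows "\<bar>\<P>(x in (\<Pi>\<^sub>M l\<in>{..<n}. P). (T n 1 x $ i - \<theta> $ i) / \<sigma> n i \<le> t) - cdf std_normal_distribution t\<bar>
    \<le> normal_approx_error P T \<theta> \<sigma> n"
proof -
  interpret PP: prob_space "\<Pi>\<^sub>M l\<in>{..<n}. P" by (intro prob_space_PiM P)
  interpret N: real_distribution std_normal_distribution by (rule real_dist_normal_dist)
  define h where "h i t = \<bar>\<P>(x in (\<Pi>\<^sub>M l\<in>{..<n}. P). (T n 1 x $ i - \<theta> $ i) / \<sigma> n i \<le> t) - cdf std_normal_distribution t\<bar>" for i t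
  have "h i t \<le> 1" for i t
  proof -
    have "0 \<le> \<P>(x in (\<Pi>\<^sub>M l\<in>{..<n}. P). (T n 1 x $ i - \<theta> $ i) / \<sigma> n i \<le> t)"
      "\<P>(x in (\<Pi>\<^sub>M l\<in>{..<n}. P). (T n 1 x $ i - \<theta> $ i) / \<sigma> n i \<le> t) \<le> 1"
      "0 \<le> cdf std_normal_distribution t" "cdf std_normal_distribution t \<le> 1"
      using PP.prob_le_1 N.prob_le_1 by (auto simp: cdf_def)
    then show ?thesis unfolding h_def by linarith
  qed
  then have "h i t \<le> (SUP t. h i t)"
    by (intro cSUP_upper) (auto intro!: bdd_aboveI2)
  also have "\<dots> \<le> (MAX i. SUP t. h i t)" by (intro Max_ge) auto
  finally show ?thesis by (simp add: h_def normal_approx_error_def)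
qed

text \<open>Dividing the derivative by its norm L and measuring lengths in units of \<sigma> leads
  to \<open>laplace_bound\<close> with c = C / \<sigma> and e = r / \<sigma>. The statement is
  applied to the errors and to their negatives.\<close>

lemma (in prob_space) one_sided_deviation:
  fixes f :: "real \<Rightarrow> real" and Y :: "'i \<Rightarrow> 'a \<Rightarrow> real"
  assumes f: "convex_on UNIV f" "\<And>x. f (- x) = f x" "filterlim f at_top at_infinity"
      "Linf_norm (avg_deriv f) < \<infinity>"
    and C: "0 < C" "\<And>x. C < \<bar>x\<bar> \<Longrightarrow> Linf_norm (right_deriv f) / 2 \<le> ereal \<bar>right_deriv f x\<bar>"
    and J: "finite J" "J \<noteq> {}" and indep: "indep_vars (\<lambda>_. borel) Y J"
    and tail: "\<And>j t. j \<in> J \<Longrightarrow> prob {x \<in> space M. t \<le> Y j x / \<sigma>} \<le> measure std_normal_distribution {t..} + g"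
    and \<sigma>: "0 < \<sigma>" and s: "0 < s" and g: "0 \<le> g"
    and small: "exp ((C / \<sigma>)\<^sup>2) * (sqrt (s / card J) + 2 * g) \<le> 33/100"
    and r: "r = 3 * exp ((C / \<sigma>)\<^sup>2) * \<sigma> * (sqrt (s / card J) + 2 * g)"
  shows "prob {x \<in> space M. (\<Sum>j\<in>J. right_deriv f (r - Y j x)) \<le> 0} \<le> exp (- 2 * s)"
proof -
  obtain L where L: "0 < L" "Linf_norm (right_deriv f) = ereal L" "\<And>x. \<bar>right_deriv f x\<bar> \<le> L"
    using right_deriv_normalization[OF f] by blast
  define \<psi> where "\<psi> x = right_deriv f (\<sigma> * x) / L" for x
  define a where "a = sqrt (s / card J)"
  define e where "e = r / \<sigma>"
  have "0 < card J" using J by (simp add: card_gt_0_iff)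
  then have a: "0 < a" "a\<^sup>2 = s / card J" using s by (simp_all add: a_def)
  have mono_r: "mono (right_deriv f)" by (rule right_deriv_mono[OF f(1)])
  have mono: "mono \<psi>"
    using \<sigma> L(1) by (auto simp: \<psi>_def mono_def intro!: divide_right_mono monoD[OF mono_r])
  have bound: "\<bar>\<psi> x\<bar> \<le> 1" for x using L by (simp add: \<psi>_def)
  have odd: "0 \<le> \<psi> x + \<psi> (- x)" for x
    using right_deriv_reflect[OF f(1,2), of "\<sigma> * x"] L(1) by (simp add: \<psi>_def flip: add_divide_distrib)
  have large: "1/2 \<le> \<psi> x" if "C / \<sigma> < x" for x
  proof -
    have x: "C < \<sigma> * x" using that \<sigma> by (simp add: field_simps)
    \<comment> \<open>The assumption on C controls only the absolute value; monotonicity and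
      reflection fix the sign on the positive half-line.\<close>
    then have "0 \<le> right_deriv f (\<sigma> * x)"
      using right_deriv_reflect[OF f(1,2), of "\<sigma> * x"] monoD[OF mono_r, of "- (\<sigma> * x)" "\<sigma> * x"] C(1) by simp
    moreover have "L / 2 \<le> \<bar>right_deriv f (\<sigma> * x)\<bar>"
      using C(2)[of "\<sigma> * x"] x C(1) L(2) by simp
    ultimately show ?thesis using L(1) by (simp add: \<psi>_def field_simps)
  qed
  have [measurable]: "\<psi> \<in> borel_measurable borel" by (rule borel_measurable_mono[OF mono])
  have Y[measurable]: "Y j \<in> borel_measurable M" if "j \<in> J" for j
    using indep that by (auto simp: indep_vars_def)
  have "prob {x \<in> space M. (\<Sum>j\<in>J. \<psi> (e - Y j x / \<sigma>)) \<le> 0} \<le> exp (- 2 * a\<^sup>2) ^ card J"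
  proof (rule prob_sum_nonpos_le[where l = "3 * a" and B = 1])
    show "indep_vars (\<lambda>_. borel) (\<lambda>j x. \<psi> (e - Y j x / \<sigma>)) J"
      by (rule indep_vars_compose2[OF indep]) simp
    fix j assume j: "j \<in> J"
    let ?\<mu> = "distr M borel (\<lambda>x. Y j x / \<sigma>)"
    have [measurable]: "Y j \<in> borel_measurable M" by (rule Y[OF j])
    have "(\<integral>w. exp (- (3 * a) * \<psi> (e - w)) \<partial>?\<mu>) \<le> exp (- 2 * a\<^sup>2)"
    proof (rule laplace_bound[where c = "C / \<sigma>" and g = g])
      show "prob_space ?\<mu>" by (rule prob_space_distr) simp
      show "measure ?\<mu> {t..} \<le> measure std_normal_distribution {t..} + g" for t
        using tail[OF j, of t] by (simp add: measure_distr vimage_def Int_def conj_commute)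
      show "e = 3 * exp ((C / \<sigma>)\<^sup>2) * (a + 2 * g)"
        using \<sigma> by (simp add: e_def r a_def)
    qed (use mono bound odd large C(1) \<sigma> a(1) g small in \<open>auto simp: a_def\<close>)
    then show "expectation (\<lambda>x. exp (- (3 * a) * \<psi> (e - Y j x / \<sigma>))) \<le> exp (- 2 * a\<^sup>2)"
      by (subst (asm) integral_distr) auto
  qed (use J bound a in auto)
  moreover have "exp (- 2 * a\<^sup>2) ^ card J = exp (- 2 * s)"
    \<comment> \<open>Each factor contributes the exponent -2 s / \<open>card J\<close>; this is why
      a is \<open>sqrt (s / card J)\<close>.\<close>
    using a \<open>0 < card J\<close> by (simp flip: exp_of_nat_mult)
  moreover have "(\<Sum>j\<in>J. \<psi> (e - Y j x / \<sigma>)) = (\<Sum>j\<in>J. right_deriv f (r - Y j x)) / L" for x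
    using \<sigma> by (simp add: \<psi>_def e_def right_diff_distrib sum_divide_distrib)
  ultimately show ?thesis using L(1) by (simp add: divide_le_0_iff)
qed

text \<open>The upper bound is \<open>minimizer_le\<close> at c + r. As f is even, - x minimizes the
  objective for the negated data, so the lower bound is the same argument after reflection.\<close>

lemma minimizer_deviation:
  fixes f :: "real \<Rightarrow> real" and t :: "'i \<Rightarrow> real"
  assumes f: "convex_on UNIV f" and even: "\<And>x. f (- x) = f x"
    and min: "\<And>z. (\<Sum>j\<in>J. f (x - t j)) \<le> (\<Sum>j\<in>J. f (z - t j))"
    and up: "0 < (\<Sum>j\<in>J. right_deriv f (r - (t j - c)))"
    and down: "0 < (\<Sum>j\<in>J. right_deriv f (r - - (t j - c)))"
  shows "\<bar>x - c\<bar> \<le> r"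
proof -
  have "x \<le> c + r"
    by (rule minimizer_le[OF f, where t = t and J = J]) (use up min in \<open>simp_all add: algebra_simps\<close>)
  moreover have "- x \<le> - c + r"
  proof (rule minimizer_le[OF f, where t = "\<lambda>j. - t j" and J = J])
    have "f (z - - t j) = f (- z - t j)" for z j
      using even[of "z + t j"] by (simp add: algebra_simps)
    then show "(\<Sum>j\<in>J. f (- x - - t j)) \<le> (\<Sum>j\<in>J. f (- c + r - - t j))"
      using min[of "- (- c + r)"] by (simp only: minus_minus)
  qed (use down in \<open>simp add: algebra_simps\<close>)
  ultimately show ?thesis by linarith
qed

text \<open>The objective is a sum over coordinates, so varying the i-th coordinate of a minimizer
  alone changes only the i-th part.\<close>

lemma is_arg_min_coordinate:
  fixes \<rho> :: "'m::finite \<Rightarrow> real \<Rightarrow> real" and t :: "'i \<Rightarrow> real ^ 'm"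
  assumes "is_arg_min (\<lambda>z. \<Sum>j\<in>J. \<Sum>i\<in>UNIV. \<rho> i (z $ i - t j $ i)) (\<lambda>_. True) x"
  shows "(\<Sum>j\<in>J. \<rho> i (x $ i - t j $ i)) \<le> (\<Sum>j\<in>J. \<rho> i (z - t j $ i))"
proof -
  define y where "y = (\<chi> l. if l = i then z else x $ l)"
  have split: "(\<Sum>j\<in>J. \<Sum>i\<in>UNIV. \<rho> i (v $ i - t j $ i))
      = (\<Sum>j\<in>J. \<rho> i (v $ i - t j $ i)) + (\<Sum>l\<in>UNIV - {i}. \<Sum>j\<in>J. \<rho> l (v $ l - t j $ l))" for v :: "real ^ 'm"
    by (subst sum.swap) (simp add: sum.remove[of UNIV i])
  have "(\<Sum>j\<in>J. \<Sum>i\<in>UNIV. \<rho> i (x $ i - t j $ i)) \<le> (\<Sum>j\<in>J. \<Sum>i\<in>UNIV. \<rho> i (y $ i - t j $ i))"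
    using assms by (simp add: is_arg_min_linorder)
  moreover have "(\<Sum>l\<in>UNIV - {i}. \<Sum>j\<in>J. \<rho> l (y $ l - t j $ l)) = (\<Sum>l\<in>UNIV - {i}. \<Sum>j\<in>J. \<rho> l (x $ l - t j $ l))"
    by (intro sum.cong) (auto simp: y_def)
  ultimately show ?thesis unfolding split by (simp add: y_def)
qed

section \<open>Union bound over coordinates and over the two sides of the error\<close>

theorem theorem5:
  fixes M :: "'a measure" and P :: "'b measure"
    and X :: "nat \<Rightarrow> 'a \<Rightarrow> 'b" and G :: "nat \<Rightarrow> 'a \<Rightarrow> nat set"
    and T :: "nat \<Rightarrow> nat \<Rightarrow> (nat \<Rightarrow> 'b) \<Rightarrow> real ^ 'm"
    and \<theta>bar :: "nat \<Rightarrow> 'a \<Rightarrow> real ^ 'm" and \<theta>hat :: "'a \<Rightarrow> real ^ 'm" and \<theta> :: "real ^ 'm"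
    and \<rho> :: "'m \<Rightarrow> real \<Rightarrow> real" and C :: "'m \<Rightarrow> real" and \<sigma> :: "nat \<Rightarrow> 'm \<Rightarrow> real"
    and g :: "nat \<Rightarrow> real" and N k n :: nat and s :: real
  assumes "prob_space M" and "prob_space P"
    and dim: "CARD('m) \<ge> 2"
    and k: "k \<ge> 1" and n: "n = N div k"
    and X_indep: "prob_space.indep_vars M (\<lambda>_. P) X {1..N}"
    and X_distr: "\<forall>l\<in>{1..N}. distr M P (X l) = P"
    and G_random: "\<forall>j\<in>{1..k}. G j \<in> M \<rightarrow>\<^sub>M count_space (Pow {1..N})"
    and G_card: "\<forall>\<omega>\<in>space M. \<forall>j\<in>{1..k}. card (G j \<omega>) = n"
    and G_disjoint: "\<forall>\<omega>\<in>space M. disjoint_family_on (\<lambda>j. G j \<omega>) {1..k}"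
    and G_indep: "prob_space.indep_set M
          (sets (vimage_algebra (space M) (\<lambda>\<omega>. \<lambda>j\<in>{1..k}. G j \<omega>)
                   (\<Pi>\<^sub>M j\<in>{1..k}. count_space (Pow {1..N}))))
          (sets (vimage_algebra (space M) (\<lambda>\<omega>. \<lambda>l\<in>{1..N}. X l \<omega>) (\<Pi>\<^sub>M l\<in>{1..N}. P)))"
    and T_measurable: "\<forall>n'. \<forall>j\<in>{1..k}. T n' j \<in> borel_measurable (\<Pi>\<^sub>M l\<in>{..<n'}. P)"
    and \<theta>bar: "\<forall>j\<in>{1..k}. \<forall>\<omega>\<in>space M. \<theta>bar j \<omega> = T n j (group_sample X (G j \<omega>) \<omega>)"
    and \<theta>bar_indep: "prob_space.indep_vars M (\<lambda>_. borel) \<theta>bar {1..k}"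
    and \<theta>bar_ident: "\<forall>j\<in>{1..k}. distr M borel (\<theta>bar j) = distr M borel (\<theta>bar 1)"
    and \<rho>_convex: "\<forall>i. convex_on UNIV (\<rho> i)"
    and \<rho>_even: "\<forall>i z. \<rho> i (- z) = \<rho> i z"
    and \<rho>_infinity: "\<forall>i. filterlim (\<rho> i) at_top at_infinity"
    and \<rho>_deriv: "\<forall>i. Linf_norm (avg_deriv (\<rho> i)) < \<infinity>"
    and \<theta>hat: "\<forall>\<omega>\<in>space M.
          is_arg_min (\<lambda>z. \<Sum>j=1..k. \<Sum>i\<in>UNIV. \<rho> i (z $ i - \<theta>bar j \<omega> $ i)) (\<lambda>_. True) (\<theta>hat \<omega>)"
    and C_pos: "\<forall>i. C i > 0"
    and C_right: "\<forall>i x. \<bar>x\<bar> > C i \<longrightarrow>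
          ereal \<bar>right_deriv (\<rho> i) x\<bar> \<ge> Linf_norm (right_deriv (\<rho> i)) / 2"
    and C_left: "\<forall>i x. \<bar>x\<bar> > C i \<longrightarrow>
          ereal \<bar>left_deriv (\<rho> i) x\<bar> \<ge> Linf_norm (left_deriv (\<rho> i)) / 2"
    and \<sigma>_pos: "\<forall>n' i. \<sigma> n' i > 0"
    and g: "g = normal_approx_error P T \<theta> \<sigma>"
    and g_lim: "g \<longlonglongrightarrow> 0"
    and s: "s > 0"
    and small: "(MAX i. exp ((C i / \<sigma> n i)\<^sup>2) * (sqrt (s / k) + 2 * g n)) \<le> 0.33"
  shows "\<exists>A\<in>sets M. measure M A \<ge> 1 - 4 * CARD('m) * exp (- 2 * s) \<and>
           (\<forall>\<omega>\<in>A. \<forall>i. \<bar>\<theta>hat \<omega> $ i - \<theta> $ i\<bar>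
              \<le> 3 * exp ((C i / \<sigma> n i)\<^sup>2) * \<sigma> n i * (sqrt (s / k) + 2 * g n))"
proof -
  interpret prob_space M by fact
  define J where "J = {1..k}"
  define \<epsilon> where "\<epsilon> = g n"
  define r where "r i = 3 * exp ((C i / \<sigma> n i)\<^sup>2) * \<sigma> n i * (sqrt (s / k) + 2 * g n)" for i
  have J: "finite J" "J \<noteq> {}" "card J = k" "1 \<in> J" using k by (auto simp: J_def)
  have rv: "\<theta>bar j \<in> borel_measurable M" if "j \<in> J" for j
    using \<theta>bar_indep that by (auto simp: indep_vars_def J_def)
  have coord[measurable]: "(\<lambda>\<omega>. \<theta>bar j \<omega> $ i) \<in> borel_measurable M" if "j \<in> J" for j i
    by (rule measurable_compose[OF rv[OF that]])
       (intro borel_measurable_continuous_onI continuous_intros)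
  \<comment> \<open>The approximation error is phrased through \<open>T n 1\<close> on the product
    space. The first random group realizes this law, and identical distribution carries it over to
    all groups.\<close>
  have law: "distr M borel (\<theta>bar j) = distr (\<Pi>\<^sub>M l\<in>{..<n}. P) borel (T n 1)" if "j \<in> J" for j
  proof -
    have "distr M borel (\<theta>bar 1) = distr (\<Pi>\<^sub>M l\<in>{..<n}. P) borel (T n 1)"
    proof (rule distr_random_group[OF \<open>prob_space P\<close> _ X_indep _ _ _ _ G_indep])
      show "G i \<omega> \<subseteq> {1..N}" if "i \<in> {1..k}" "\<omega> \<in> space M" for i \<omega>
        using measurable_space[of "G i" M "count_space (Pow {1..N})" \<omega>] G_random that by auto
    qed (use X_distr k G_card T_measurable \<theta>bar rv J(4) in auto)
    moreover have "distr M borel (\<theta>bar j) = distr M borel (\<theta>bar 1)"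
      using \<theta>bar_ident that unfolding J_def by blast
    ultimately show ?thesis by simp
  qed
  have close: "\<bar>cdf (distr M borel (\<lambda>\<omega>. (\<theta>bar j \<omega> $ i - \<theta> $ i) / \<sigma> n i)) t - cdf std_normal_distribution t\<bar> \<le> \<epsilon>"
    if j: "j \<in> J" for j i t
  proof -
    have S: "{v :: real ^ 'm. (v $ i - \<theta> $ i) / \<sigma> n i \<le> t} \<in> sets borel"
      by measurable
    have [measurable]: "\<theta>bar j \<in> borel_measurable M" by (rule rv[OF j])
    have Tm: "T n 1 \<in> borel_measurable (\<Pi>\<^sub>M l\<in>{..<n}. P)" using T_measurable k by simp
    have "cdf (distr M borel (\<lambda>\<omega>. (\<theta>bar j \<omega> $ i - \<theta> $ i) / \<sigma> n i)) t
        = measure (distr M borel (\<theta>bar j)) {v. (v $ i - \<theta> $ i) / \<sigma> n i \<le> t}"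
      using coord[OF j] S by (simp add: cdf_def measure_distr vimage_def)
    also have "\<dots> = \<P>(x in (\<Pi>\<^sub>M l\<in>{..<n}. P). (T n 1 x $ i - \<theta> $ i) / \<sigma> n i \<le> t)"
      unfolding law[OF j] using Tm S by (simp add: measure_distr vimage_def Int_def conj_commute)
    finally show ?thesis
      using normal_approx_error_ge[OF \<open>prob_space P\<close>, of n T i \<theta> \<sigma> t] by (simp add: \<epsilon>_def g)
  qed
  have \<epsilon>: "0 \<le> \<epsilon>" using close[OF J(4)] abs_ge_zero order_trans by blast
  have small_i: "exp ((C i / \<sigma> n i)\<^sup>2) * (sqrt (s / k) + 2 * g n) \<le> 33/100" for i
  proof -
    have "exp ((C i / \<sigma> n i)\<^sup>2) * (sqrt (s / k) + 2 * g n)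
        \<le> (MAX i. exp ((C i / \<sigma> n i)\<^sup>2) * (sqrt (s / k) + 2 * g n))"
      by (intro Max_ge) auto
    then show ?thesis using small by simp
  qed
  \<comment> \<open>\<open>U i\<close> and \<open>D i\<close> contain the outcomes at which the i-th
    coordinate may exceed the bound upwards or downwards.\<close>
  define U where "U i = {\<omega> \<in> space M. (\<Sum>j\<in>J. right_deriv (\<rho> i) (r i - (\<theta>bar j \<omega> $ i - \<theta> $ i))) \<le> 0}" for i
  define D where "D i = {\<omega> \<in> space M. (\<Sum>j\<in>J. right_deriv (\<rho> i) (r i - - (\<theta>bar j \<omega> $ i - \<theta> $ i))) \<le> 0}" for i
  have conv: "convex_on UNIV (\<rho> i)" for i using \<rho>_convex by simp
  have [measurable]: "right_deriv (\<rho> i) \<in> borel_measurable borel" for i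
    by (rule borel_measurable_mono[OF right_deriv_mono[OF conv]])
  have UD: "U i \<in> events" "D i \<in> events" for i unfolding U_def D_def by measurable
  have dev: "prob {\<omega> \<in> space M. (\<Sum>j\<in>J. right_deriv (\<rho> i) (r i - Y j \<omega>)) \<le> 0} \<le> exp (- 2 * s)"
    if "indep_vars (\<lambda>_. borel) Y J"
      "\<And>j t. j \<in> J \<Longrightarrow> prob {\<omega> \<in> space M. t \<le> Y j \<omega> / \<sigma> n i} \<le> measure std_normal_distribution {t..} + \<epsilon>"
    for Y i
    by (rule one_sided_deviation[where C = "C i" and g = \<epsilon> and \<sigma> = "\<sigma> n i", OF conv _ _ _ _ _ J(1,2) that])
       (use \<rho>_even \<rho>_infinity \<rho>_deriv C_pos C_right \<sigma>_pos s \<epsilon> small_i in \<open>auto simp: r_def \<epsilon>_def J(3)\<close>)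
  have tails: "prob {\<omega> \<in> space M. t \<le> (\<theta>bar j \<omega> $ i - \<theta> $ i) / \<sigma> n i} \<le> measure std_normal_distribution {t..} + \<epsilon>"
    "prob {\<omega> \<in> space M. t \<le> - (\<theta>bar j \<omega> $ i - \<theta> $ i) / \<sigma> n i} \<le> measure std_normal_distribution {t..} + \<epsilon>"
    if j: "j \<in> J" for i j t
  proof -
    let ?W = "\<lambda>\<omega>. (\<theta>bar j \<omega> $ i - \<theta> $ i) / \<sigma> n i"
    have W[measurable]: "?W \<in> borel_measurable M" using coord[OF j] by measurable
    have m: "measure (distr M borel ?W) {t..} = prob {\<omega> \<in> space M. t \<le> ?W \<omega>}"
      "measure (distr M borel ?W) {.. - t} = prob {\<omega> \<in> space M. t \<le> - (\<theta>bar j \<omega> $ i - \<theta> $ i) / \<sigma> n i}"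
      by (simp_all only: measure_distr[OF W] atLeast_borel atMost_borel)
         (auto intro!: arg_cong[where f = prob] simp: le_minus_iff[of t] simp del: minus_diff_eq)
    have "prob_space (distr M borel ?W)" "sets (distr M borel ?W) = sets borel"
      by (simp_all add: prob_space_distr)
    from tail_le_of_cdf_close[OF this close[OF j], of t, unfolded m]
    show "prob {\<omega> \<in> space M. t \<le> (\<theta>bar j \<omega> $ i - \<theta> $ i) / \<sigma> n i} \<le> measure std_normal_distribution {t..} + \<epsilon>"
      "prob {\<omega> \<in> space M. t \<le> - (\<theta>bar j \<omega> $ i - \<theta> $ i) / \<sigma> n i} \<le> measure std_normal_distribution {t..} + \<epsilon>"
      by blast+
  qed
  have indepJ: "indep_vars (\<lambda>_. borel) \<theta>bar J" using \<theta>bar_indep by (simp add: J_def)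
  have prob_U: "prob (U i) \<le> exp (- 2 * s)" for i
    unfolding U_def by (rule dev[OF indep_vars_compose2[OF indepJ] tails(1)]) auto
  have prob_D: "prob (D i) \<le> exp (- 2 * s)" for i
    unfolding D_def by (rule dev[OF indep_vars_compose2[OF indepJ] tails(2)]) auto
  define A where "A = space M - (\<Union>i. U i \<union> D i)"
  have A: "A \<in> sets M" unfolding A_def using UD by auto
  \<comment> \<open>Two exceptional events per coordinate give total probability at most 2 m exp(-2
    s), half of the amount allowed.\<close>
  have "prob (\<Union>i. U i \<union> D i) \<le> (\<Sum>i\<in>UNIV. prob (U i \<union> D i))"
    using UD by (intro finite_measure_subadditive_finite) auto
  also have "\<dots> \<le> (\<Sum>i\<in>(UNIV :: 'm set). 2 * exp (- 2 * s))"
  proof (rule sum_mono)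
    fix i show "prob (U i \<union> D i) \<le> 2 * exp (- 2 * s)"
      using measure_Un_le[OF UD(1,2), of i i] prob_U[of i] prob_D[of i] by simp
  qed
  also have "\<dots> \<le> 4 * CARD('m) * exp (- 2 * s)" by simp
  finally have "1 - 4 * CARD('m) * exp (- 2 * s) \<le> prob A"
    unfolding A_def using UD by (subst prob_compl) auto
  moreover have "\<bar>\<theta>hat \<omega> $ i - \<theta> $ i\<bar> \<le> r i" if \<omega>: "\<omega> \<in> A" for \<omega> i
  proof (rule minimizer_deviation[OF conv[of i], where J = J and t = "\<lambda>j. \<theta>bar j \<omega> $ i"])
    have "\<omega> \<in> space M" "\<omega> \<notin> U i" "\<omega> \<notin> D i" using \<omega> by (auto simp: A_def)
    then show "0 < (\<Sum>j\<in>J. right_deriv (\<rho> i) (r i - (\<theta>bar j \<omega> $ i - \<theta> $ i)))"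
      "0 < (\<Sum>j\<in>J. right_deriv (\<rho> i) (r i - - (\<theta>bar j \<omega> $ i - \<theta> $ i)))"
      by (auto simp: U_def D_def)
    show "(\<Sum>j\<in>J. \<rho> i (\<theta>hat \<omega> $ i - \<theta>bar j \<omega> $ i)) \<le> (\<Sum>j\<in>J. \<rho> i (z - \<theta>bar j \<omega> $ i))" for z
      using \<theta>hat \<open>\<omega> \<in> space M\<close> unfolding J_def by (intro is_arg_min_coordinate) auto
  qed (use \<rho>_even in simp)
  ultimately show ?thesis using A unfolding r_def by blast
qed

end
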